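(* Let $k\ge1$, $\ell\ge 4$ be integers, let $t=(\ell^2-\ell+1)k+\frac{\ell^2+3\ell-2}{2}$, and let $n\ge 8\left(k+\lfloor \ell/2\rfloor\right)^3t^8$. (1) If $\ell$ is even, then $\mathrm{Ex}_{sp}(n,\,kS_{\ell-1}\cup P_\ell)=\{S_{n,\,\frac{2k+\ell-2}{2}}\}$. (2) If $\ell$ is odd, then $\mathrm{Ex}_{sp}(n,\,kS_{\ell-1}\cup P_\ell)=\{S^{+}_{n,\,\frac{2k+\ell-3}{2}}\}$.
   Context: $P_n$ is the path of order $n$; $S_{n-1}$ is the star of order $n$ (so $S_{\ell-1}=K_{1,\ell-1}$). $kH$ denotes the vertex-disjoint union of $k$ copies of $H$, $\cup$ vertex-disjoint union. A graph is $F$-free if it has no subgraph isomorphic to $F$. $\mathrm{Ex}_{sp}(n,F)$ is the set of $F$-free graphs of order $n$ with maximum spectral radius (largest adjacency eigenvalue) among all $F$-free graphs of order $n$. $S_{n,h}=K_h\vee\overline{K}_{n-h}$ and $S^{+}_{n,h}=K_h\vee(K_2\cup\overline{K}_{n-h-2})$, where $\vee$ is the join. *)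

theory Defs
  imports "Jordan_Normal_Form.Char_Poly"
begin

definition simple_graph :: "'a set \<Rightarrow> 'a set set \<Rightarrow> bool" where
  "simple_graph V E \<longleftrightarrow> finite V \<and> (\<forall>e\<in>E. \<exists>u v. e = {u, v} \<and> u \<noteq> v \<and> u \<in> V \<and> v \<in> V)"

definition has_subgraph :: "nat set \<Rightarrow> nat set set \<Rightarrow> nat set \<Rightarrow> nat set set \<Rightarrow> bool" where
  "has_subgraph V E VF EF \<longleftrightarrow>
     (\<exists>f. inj_on f VF \<and> f ` VF \<subseteq> V \<and> (\<forall>e\<in>EF. f ` e \<in> E))"

definition F_free :: "nat set \<Rightarrow> nat set set \<Rightarrow> nat set \<Rightarrow> nat set set \<Rightarrow> bool" where
  "F_free VF EF V E \<longleftrightarrow> \<not> has_subgraph V E VF EF"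

definition adj_mat :: "nat \<Rightarrow> nat set set \<Rightarrow> real mat" where
  "adj_mat n E = mat n n (\<lambda>(i, j). if {i, j} \<in> E then 1 else 0)"

definition spec_rad :: "nat \<Rightarrow> nat set set \<Rightarrow> real" where
  "spec_rad n E = Max {\<mu>. eigenvalue (adj_mat n E) \<mu>}"

definition spex :: "nat set \<Rightarrow> nat set set \<Rightarrow> nat \<Rightarrow> nat set set \<Rightarrow> bool" where
  "spex VF EF n E \<longleftrightarrow> simple_graph {0..<n} E \<and> F_free VF EF {0..<n} E \<and>
     (\<forall>E'. simple_graph {0..<n} E' \<and> F_free VF EF {0..<n} E' \<longrightarrow> spec_rad n E' \<le> spec_rad n E)"

definition graph_iso :: "nat \<Rightarrow> nat set set \<Rightarrow> nat set set \<Rightarrow> bool" where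
  "graph_iso n E E' \<longleftrightarrow> (\<exists>p. bij_betw p {0..<n} {0..<n} \<and> E' = (\<lambda>e. p ` e) ` E)"

text \<open>The forbidden graph k S_{l-1} \<union> P_l on vertices {0..<(k+1)*l}:
  for i < k, star i has centre i*l and leaves i*l+1, ..., i*l+l-1;
  the path is k*l, k*l+1, ..., k*l+l-1.\<close>
definition F_vert :: "nat \<Rightarrow> nat \<Rightarrow> nat set" where
  "F_vert k l = {0..<(k+1)*l}"

definition F_edges :: "nat \<Rightarrow> nat \<Rightarrow> nat set set" where
  "F_edges k l = {{i*l, i*l + j} | i j. i < k \<and> 1 \<le> j \<and> j < l}
              \<union> {{k*l + j, k*l + j + 1} | j. j + 1 < l}"

text \<open>S_{n,h} = K_h join (complement of K_{n-h}) on {0..<n}, clique on {0..<h}.\<close>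
definition S_graph :: "nat \<Rightarrow> nat \<Rightarrow> nat set set" where
  "S_graph n h = {{u, v} | u v. u < n \<and> v < n \<and> u \<noteq> v \<and> (u < h \<or> v < h)}"

text \<open>S^+_{n,h} = K_h join (K_2 \<union> complement of K_{n-h-2}); the K_2 is {h, h+1}.\<close>
definition S_plus_graph :: "nat \<Rightarrow> nat \<Rightarrow> nat set set" where
  "S_plus_graph n h = S_graph n h \<union> {{h, h + 1}}"

end

theory Submission
  imports Defs "HOL-Analysis.Function_Topology"
begin

text \<open>
  Put \<open>h = k + l div 2 - 1\<close>, one less than the vertex cover number of the forbidden forest, and
  let \<open>x\<close> be a nonnegative eigenvector of an extremal graph, with maximal entry 1 at \<open>u\<close>.
  Peeling off vertices of small degree shows that a bipartite piece between a small set \<open>A\<close> and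
  a set \<open>B\<close> has at most \<open>h |B| + O(|A|)\<close> edges.  If the graph had no path on \<open>l\<close> vertices, the
  same argument with a smaller \<open>h\<close> would bound the spectral radius below that of \<open>S_{n,h}\<close>.
  Otherwise all but boundedly many vertices have bounded degree, hence tiny entries of \<open>x\<close>.
  Counting weighted walks of length two from \<open>u\<close> then yields exactly \<open>h\<close> vertices with entry
  close to 1, the core, and almost every other vertex is adjacent to the whole core.
  Finally the quadratic form at \<open>x\<close> is compared with that of the graph in which every vertex is
  joined to the core: an exceptional vertex missing a core neighbour gains at least half of its
  entry and loses at most a quarter of it, so there are none, and an edge (two edges, if \<open>l\<close> is
  odd) off the core would create the forbidden forest.
\<close>

subsection \<open>The spectral radius as a maximal Rayleigh quotient\<close>

text \<open>What makes the forest easy to embed is that a vertex of degree at least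
  \<open>(k + 1) * l\<close>, the order of the forest, can always be completed to a star avoiding
  everything used so far. So the forest appears as soon as a path leaves \<open>k\<close> such
  vertices free, and an alternating path consumes only \<open>l div 2\<close> of them. The case
  split on a path is needed to bound the number of these vertices: once one path on \<open>l\<close>
  vertices exists, fewer than \<open>k\<close> of them lie off it. One extra edge is harmless
  exactly for odd \<open>l\<close>, because a path of odd order keeps a matching of size
  \<open>l div 2\<close> after losing any one edge. The graph is not known to be connected, so
  \<open>x\<close> might vanish on exceptional vertices and the comparison of quadratic forms alone
  does not exclude them. It does force equality, which makes \<open>x\<close> an eigenvector of the
  comparison graph, and positivity comes from there. With \<open>N = (k + 1) * l\<close>, the bound
  on \<open>n\<close> is spent on \<open>lam \<ge> 162 * (h + 1)^2 * N^4\<close>; the main errors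
  are measured by \<open>rho = 3 * N^2 * n / lam\<close>, which is then tiny against
  \<open>n\<close>.\<close>

definition edge_ind :: "nat set set \<Rightarrow> nat \<Rightarrow> nat \<Rightarrow> real" where
  "edge_ind E i j = (if {i, j} \<in> E then 1 else 0)"

definition qform :: "nat \<Rightarrow> nat set set \<Rightarrow> (nat \<Rightarrow> real) \<Rightarrow> real" where
  "qform n E x = (\<Sum>i\<in>{0..<n}. \<Sum>j\<in>{0..<n}. edge_ind E i j * (x i * x j))"

definition sqn :: "nat \<Rightarrow> (nat \<Rightarrow> real) \<Rightarrow> real" where
  "sqn n x = (\<Sum>i\<in>{0..<n}. (x i)\<^sup>2)"

lemma edge_ind_sym: "edge_ind E i j = edge_ind E j i"
  by (simp add: edge_ind_def insert_commute)

lemma sqn_nonneg: "sqn n x \<ge> 0"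
  by (simp add: sqn_def sum_nonneg)

lemma sqn_eq_0_iff: "sqn n x = 0 \<longleftrightarrow> (\<forall>i<n. x i = 0)"
  by (auto simp: sqn_def sum_nonneg_eq_0_iff)

lemma qform_scale: "qform n E (\<lambda>i. c * x i) = c\<^sup>2 * qform n E x"
  by (simp add: qform_def sum_distrib_left power2_eq_square mult_ac)

lemma sqn_scale: "sqn n (\<lambda>i. c * x i) = c\<^sup>2 * sqn n x"
  by (simp add: sqn_def sum_distrib_left power_mult_distrib)

lemma qform_cong: "(\<And>i. i < n \<Longrightarrow> x i = y i) \<Longrightarrow> qform n E x = qform n E y"
  unfolding qform_def by (intro sum.cong refl) auto

lemma sqn_cong: "(\<And>i. i < n \<Longrightarrow> x i = y i) \<Longrightarrow> sqn n x = sqn n y"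
  unfolding sqn_def by (intro sum.cong refl) auto

lemma qform_maximiser_exists:
  assumes "n > 0"
  shows "\<exists>x. sqn n x = 1 \<and> (\<forall>y. sqn n y = 1 \<longrightarrow> qform n E y \<le> qform n E x)"
proof -
  define K :: "(nat \<Rightarrow> real) set" where
    "K = PiE UNIV (\<lambda>i. if i < n then {-1..1} else {0})"
  have "compactin (product_topology (\<lambda>i. euclidean) UNIV) K"
    unfolding K_def compactin_PiE by auto
  then have K: "compact K"
    by (simp add: euclidean_product_topology)
  have c: "continuous_on UNIV (\<lambda>x :: nat \<Rightarrow> real. x i)" for i
    by simp
  have cs: "continuous_on UNIV (sqn n)" and cq: "continuous_on UNIV (qform n E)"
    unfolding sqn_def[abs_def] qform_def[abs_def]
    by (intro continuous_intros c)+
  have "closed {x. sqn n x = 1}"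
    using continuous_closed_preimage_constant[OF cs closed_UNIV] by simp
  then have comp: "compact (K \<inter> {x. sqn n x = 1})"
    using K by blast
  have inK: "(\<lambda>i. if i < n then y i else 0) \<in> K \<inter> {x. sqn n x = 1}" if "sqn n y = 1" for y
  proof -
    have "y i \<in> {-1..1}" if "i < n" for i
    proof -
      have "(y i)\<^sup>2 \<le> sqn n y"
        unfolding sqn_def using that by (intro member_le_sum) auto
      then have "(y i)\<^sup>2 \<le> 1"
        using \<open>sqn n y = 1\<close> by simp
      then have "\<bar>y i\<bar> \<le> 1"
        by (simp add: abs_square_le_1)
      then show ?thesis
        by (simp add: abs_le_iff)
    qed
    moreover have "sqn n (\<lambda>i. if i < n then y i else 0) = sqn n y"
      by (intro sqn_cong) auto
    ultimately show ?thesis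
      using that by (auto simp: K_def)
  qed
  have "sqn n (\<lambda>i. if i = 0 then 1 else 0) = 1"
    using assms by (simp add: sqn_def if_distrib[of "\<lambda>z. z\<^sup>2"] cong: if_cong)
  then have "K \<inter> {x. sqn n x = 1} \<noteq> {}"
    using inK by blast
  from continuous_attains_sup[OF comp this continuous_on_subset[OF cq]]
  obtain x where x: "sqn n x = 1" "\<And>y. y \<in> K \<inter> {x. sqn n x = 1} \<Longrightarrow> qform n E y \<le> qform n E x"
    by auto
  have "qform n E y \<le> qform n E x" if "sqn n y = 1" for y
  proof -
    have "qform n E y = qform n E (\<lambda>i. if i < n then y i else 0)"
      by (intro qform_cong) auto
    then show ?thesis
      using x(2)[OF inK[OF that]] by simp
  qed
  with x(1) show ?thesis by blast
qed

text \<open>First-order condition: \<open>M * sqn - qform\<close> is nonnegative and vanishes at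
  \<open>x\<close>, so its derivative in the direction of coordinate \<open>i\<close> is
  zero.\<close>

lemma maximiser_is_eigenvector:
  assumes ub: "\<And>y. qform n E y \<le> M * sqn n y" and eq: "qform n E x = M * sqn n x" and i: "i < n"
  shows "(\<Sum>j\<in>{0..<n}. edge_ind E i j * x j) = M * x i"
proof -
  define b where "b = (\<Sum>j\<in>{0..<n}. edge_ind E i j * x j)"
  define e :: "nat \<Rightarrow> real" where "e j = (if j = i then 1 else 0)" for j
  define g where "g = M - edge_ind E i i"
  have q: "qform n E (\<lambda>j. x j + s * e j) = qform n E x + 2 * s * b + s\<^sup>2 * edge_ind E i i" for s
  proof -
    have "qform n E (\<lambda>j. x j + s * e j) =
      (\<Sum>a\<in>{0..<n}. \<Sum>j\<in>{0..<n}. edge_ind E a j * (x a * x j)) +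
      s * (\<Sum>a\<in>{0..<n}. \<Sum>j\<in>{0..<n}. edge_ind E a j * e a * x j) +
      s * (\<Sum>a\<in>{0..<n}. \<Sum>j\<in>{0..<n}. edge_ind E a j * x a * e j) +
      s\<^sup>2 * (\<Sum>a\<in>{0..<n}. \<Sum>j\<in>{0..<n}. edge_ind E a j * e a * e j)"
      unfolding qform_def sum_distrib_left sum.distrib[symmetric]
      by (intro sum.cong refl) (simp add: algebra_simps power2_eq_square)
    moreover have "(\<Sum>a\<in>{0..<n}. \<Sum>j\<in>{0..<n}. edge_ind E a j * e a * x j) = b"
    proof -
      have "(\<Sum>a\<in>{0..<n}. \<Sum>j\<in>{0..<n}. edge_ind E a j * e a * x j)
          = (\<Sum>a\<in>{0..<n}. if a = i then b else 0)"
        by (intro sum.cong refl) (auto simp: e_def b_def)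
      then show ?thesis using i by simp
    qed
    moreover have "(\<Sum>a\<in>{0..<n}. \<Sum>j\<in>{0..<n}. edge_ind E a j * x a * e j) = b"
    proof -
      have "(\<Sum>j\<in>{0..<n}. edge_ind E a j * x a * e j) = edge_ind E i a * x a" for a
      proof -
        have "(\<Sum>j\<in>{0..<n}. edge_ind E a j * x a * e j)
          = (\<Sum>j\<in>{0..<n}. if j = i then edge_ind E a i * x a else 0)"
          by (intro sum.cong refl) (auto simp: e_def)
        then show ?thesis using i by (simp add: edge_ind_sym)
      qed
      then show ?thesis by (simp add: b_def)
    qed
    moreover have "(\<Sum>a\<in>{0..<n}. \<Sum>j\<in>{0..<n}. edge_ind E a j * e a * e j) = edge_ind E i i"
    proof -
      have "(\<Sum>j\<in>{0..<n}. edge_ind E a j * e a * e j) = (if a = i then edge_ind E i i else 0)" for a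
      proof -
        have "(\<Sum>j\<in>{0..<n}. edge_ind E a j * e a * e j)
          = (\<Sum>j\<in>{0..<n}. if j = i then (if a = i then edge_ind E i i else 0) else 0)"
          by (intro sum.cong refl) (auto simp: e_def)
        then show ?thesis using i by simp
      qed
      then show ?thesis using i by simp
    qed
    ultimately show ?thesis by (simp add: qform_def)
  qed
  have sq: "sqn n (\<lambda>j. x j + s * e j) = sqn n x + 2 * s * x i + s\<^sup>2" for s
  proof -
    have "sqn n (\<lambda>j. x j + s * e j) =
      (\<Sum>j\<in>{0..<n}. (x j)\<^sup>2 + (if j = i then 2 * s * x i + s\<^sup>2 else 0))"
      unfolding sqn_def
      by (intro sum.cong refl) (auto simp: e_def power2_eq_square algebra_simps)
    then show ?thesis
      using i by (simp add: sum.distrib sqn_def)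
  qed
  have key: "0 \<le> 2 * s * (M * x i - b) + s\<^sup>2 * g" for s
    using ub[of "\<lambda>j. x j + s * e j"] unfolding q sq eq by (simp add: g_def algebra_simps)
  define d where "d = M * x i - b"
  \<comment> \<open>Since \<open>c\<close> is positive and exceeds \<open>g\<close>, the step
    \<open>s = - d / c\<close> makes the quadratic in \<open>key\<close> negative unless
    \<open>d = 0\<close>.\<close>
  define c where "c = \<bar>g\<bar> + 1"
  have c: "c > 0" "g < c" by (auto simp: c_def)
  have "d = 0"
  proof (rule ccontr)
    assume "d \<noteq> 0"
    then have "d\<^sup>2 > 0" by simp
    have "0 \<le> 2 * (- d / c) * d + (- d / c)\<^sup>2 * g"
      using key[of "- d / c"] by (simp add: d_def)
    also have "\<dots> = d\<^sup>2 / c\<^sup>2 * (g - 2 * c)"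
      using c by (simp add: field_simps power2_eq_square)
    also have "\<dots> < 0"
      using c \<open>d\<^sup>2 > 0\<close> by (intro mult_pos_neg divide_pos_pos) auto
    finally show False by simp
  qed
  then show ?thesis by (simp add: d_def b_def)
qed

lemma eigenvector_qform:
  assumes "\<And>i. i < n \<Longrightarrow> (\<Sum>j\<in>{0..<n}. edge_ind E i j * x j) = M * x i"
  shows "qform n E x = M * sqn n x"
proof -
  have "qform n E x = (\<Sum>i\<in>{0..<n}. x i * (\<Sum>j\<in>{0..<n}. edge_ind E i j * x j))"
    unfolding qform_def sum_distrib_left by (intro sum.cong refl) (simp add: mult_ac)
  also have "\<dots> = (\<Sum>i\<in>{0..<n}. x i * (M * x i))"
    using assms by (intro sum.cong refl) auto
  also have "\<dots> = M * sqn n x"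
    by (simp add: sqn_def sum_distrib_left power2_eq_square mult_ac)
  finally show ?thesis .
qed

lemma eigenvalue_adj_mat_iff:
  "eigenvalue (adj_mat n E) \<mu> \<longleftrightarrow>
    (\<exists>x. (\<exists>i<n. x i \<noteq> 0) \<and> (\<forall>i<n. (\<Sum>j\<in>{0..<n}. edge_ind E i j * x j) = \<mu> * x i))"
proof
  assume "eigenvalue (adj_mat n E) \<mu>"
  then obtain v where v: "v \<in> carrier_vec n" "v \<noteq> 0\<^sub>v n" "adj_mat n E *\<^sub>v v = \<mu> \<cdot>\<^sub>v v"
    unfolding eigenvalue_def eigenvector_def by (auto simp: adj_mat_def)
  have "\<exists>i<n. vec_index v i \<noteq> 0"
    using v(1,2) by (auto simp: vec_eq_iff)
  moreover have "(\<Sum>j\<in>{0..<n}. edge_ind E i j * vec_index v j) = \<mu> * vec_index v i" if "i < n" for i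
  proof -
    have "vec_index (adj_mat n E *\<^sub>v v) i = (\<Sum>j\<in>{0..<n}. edge_ind E i j * vec_index v j)"
      using that v(1) by (simp add: adj_mat_def scalar_prod_def edge_ind_def)
    then show ?thesis
      using v(1,3) that by simp
  qed
  ultimately show "\<exists>x. (\<exists>i<n. x i \<noteq> 0) \<and> (\<forall>i<n. (\<Sum>j\<in>{0..<n}. edge_ind E i j * x j) = \<mu> * x i)"
    by (intro exI[of _ "\<lambda>i. vec_index v i"]) auto
next
  assume "\<exists>x. (\<exists>i<n. x i \<noteq> 0) \<and> (\<forall>i<n. (\<Sum>j\<in>{0..<n}. edge_ind E i j * x j) = \<mu> * x i)"
  then obtain x i0 where x: "i0 < n" "x i0 \<noteq> 0"
    "\<And>i. i < n \<Longrightarrow> (\<Sum>j\<in>{0..<n}. edge_ind E i j * x j) = \<mu> * x i" by blast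
  have "vec n x \<noteq> 0\<^sub>v n"
  proof
    assume "vec n x = 0\<^sub>v n"
    then have "vec_index (vec n x) i0 = vec_index (0\<^sub>v n) i0" by simp
    then show False using x by simp
  qed
  moreover have "adj_mat n E *\<^sub>v vec n x = \<mu> \<cdot>\<^sub>v vec n x"
    by (intro eq_vecI) (auto simp: adj_mat_def scalar_prod_def x(3)[symmetric] edge_ind_def)
  ultimately show "eigenvalue (adj_mat n E) \<mu>"
    unfolding eigenvalue_def eigenvector_def by (intro exI[of _ "vec n x"]) (auto simp: adj_mat_def)
qed

text \<open>The maximal Rayleigh quotient is an eigenvalue and bounds every other one, so it is the
  \<open>Max\<close> in \<open>spec_rad\<close>. Adjacency entries are nonnegative, so taking
  absolute values does not decrease \<open>qform\<close> and yields a nonnegative maximiser.\<close>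

lemma spec_rad_Rayleigh:
  assumes "n > 0"
  shows "\<exists>x. (\<forall>i. x i \<ge> 0) \<and> (\<exists>i<n. x i \<noteq> 0) \<and> qform n E x = spec_rad n E * sqn n x"
    and "qform n E y \<le> spec_rad n E * sqn n y"
proof -
  obtain x where x: "sqn n x = 1" "\<And>y. sqn n y = 1 \<Longrightarrow> qform n E y \<le> qform n E x"
    using qform_maximiser_exists[OF assms] by metis
  define M where "M = qform n E x"
  have ub: "qform n E y \<le> M * sqn n y" for y
  proof (cases "sqn n y = 0")
    case True
    then have "qform n E y = 0"
      by (auto simp: qform_def sqn_eq_0_iff)
    then show ?thesis using True by simp
  next
    case False
    define c where "c = 1 / sqrt (sqn n y)"
    have pos: "sqn n y > 0" using False sqn_nonneg[of n y] by linarith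
    then have c: "c\<^sup>2 * sqn n y = 1"
      by (simp add: c_def power_divide)
    then have "qform n E (\<lambda>i. c * y i) \<le> M"
      unfolding M_def by (intro x(2)) (simp add: sqn_scale)
    then have "c\<^sup>2 * qform n E y \<le> M * (c\<^sup>2 * sqn n y)"
      using c by (simp add: qform_scale)
    moreover have "c\<^sup>2 > 0" using pos by (simp add: c_def)
    ultimately show ?thesis
      by (metis mult.left_commute mult_le_cancel_left_pos)
  qed
  define z where "z i = \<bar>x i\<bar>" for i
  have z1: "sqn n z = 1" using x(1) by (simp add: sqn_def z_def)
  have "M \<le> qform n E z"
    unfolding M_def qform_def z_def
    by (intro sum_mono mult_left_mono) (auto simp: edge_ind_def abs_mult[symmetric])
  then have zM: "qform n E z = M * sqn n z"
    using ub[of z] z1 by simp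
  have znz: "\<exists>i<n. z i \<noteq> 0"
    using z1 by (metis sqn_eq_0_iff zero_neq_one)
  have ev: "eigenvalue (adj_mat n E) M"
    unfolding eigenvalue_adj_mat_iff
    using maximiser_is_eigenvector[OF ub zM] znz by blast
  have le: "\<mu> \<le> M" if ev: "eigenvalue (adj_mat n E) \<mu>" for \<mu>
  proof -
    obtain v where "(\<exists>i<n. v i \<noteq> 0) \<and>
        (\<forall>i<n. (\<Sum>j\<in>{0..<n}. edge_ind E i j * v j) = \<mu> * v i)"
      using ev[unfolded eigenvalue_adj_mat_iff] by (rule exE)
    then have v: "\<exists>i<n. v i \<noteq> 0"
      "\<And>i. i < n \<Longrightarrow> (\<Sum>j\<in>{0..<n}. edge_ind E i j * v j) = \<mu> * v i"
      by auto
    have "sqn n v > 0"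
      using v(1) sqn_nonneg[of n v] sqn_eq_0_iff[of n v] by fastforce
    moreover have "\<mu> * sqn n v \<le> M * sqn n v"
      using ub[of v] eigenvector_qform[OF v(2)] by simp
    ultimately show ?thesis by simp
  qed
  \<comment> \<open>\<open>Max\<close> is meaningful only on a finite set; the eigenvalues are the
    roots of a monic polynomial.\<close>
  have car: "adj_mat n E \<in> carrier_mat n n" by (simp add: adj_mat_def)
  have "finite {\<mu>. poly (char_poly (adj_mat n E)) \<mu> = 0}"
    using degree_monic_char_poly[OF car] by (intro poly_roots_finite) auto
  then have "finite {\<mu>. eigenvalue (adj_mat n E) \<mu>}"
    by (simp add: eigenvalue_root_char_poly[OF car])
  then have sM: "spec_rad n E = M"
    unfolding spec_rad_def using ev le by (intro Max_eqI) auto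
  show "\<exists>x. (\<forall>i. x i \<ge> 0) \<and> (\<exists>i<n. x i \<noteq> 0) \<and> qform n E x = spec_rad n E * sqn n x"
    using zM znz unfolding sM by (intro exI[of _ z]) (auto simp: z_def)
  show "qform n E y \<le> spec_rad n E * sqn n y"
    using ub unfolding sM .
qed

lemma spec_rad_eigenvector:
  assumes "n > 0"
  obtains x u where "\<And>i. x i \<ge> 0" "\<And>i. i < n \<Longrightarrow> x i \<le> 1" "u < n" "x u = 1"
    "\<And>i. i < n \<Longrightarrow> (\<Sum>j\<in>{0..<n}. edge_ind E i j * x j) = spec_rad n E * x i"
proof -
  obtain z where z: "\<And>i. z i \<ge> 0" "\<exists>i<n. z i \<noteq> 0" "qform n E z = spec_rad n E * sqn n z"
    using spec_rad_Rayleigh(1)[OF assms] by blast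
  have ev: "(\<Sum>j\<in>{0..<n}. edge_ind E i j * z j) = spec_rad n E * z i" if "i < n" for i
    using maximiser_is_eigenvector[OF spec_rad_Rayleigh(2)[OF assms] z(3) that] .
  define m where "m = Max (z ` {0..<n})"
  have "m \<in> z ` {0..<n}" unfolding m_def using assms by (intro Max_in) auto
  then obtain u where u: "u < n" "z u = m" by auto
  have mle: "z i \<le> m" if "i < n" for i
    unfolding m_def using that by (intro Max_ge) auto
  obtain i0 where "i0 < n" "z i0 \<noteq> 0" using z(2) by blast
  then have m: "m > 0" using mle[of i0] z(1)[of i0] by linarith
  show thesis
  proof
    show "z i / m \<ge> 0" for i using z m by simp
    show "z i / m \<le> 1" if "i < n" for i using mle[OF that] m by simp
    show "u < n" "z u / m = 1" using u m by auto
    show "(\<Sum>j\<in>{0..<n}. edge_ind E i j * (z j / m)) = spec_rad n E * (z i / m)" if "i < n" for i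
      using ev[OF that] by (simp add: sum_divide_distrib[symmetric])
  qed
qed

lemma qform_permute:
  assumes p: "bij_betw p {0..<n} {0..<n}" and E: "simple_graph {0..<n} E"
  shows "qform n ((\<lambda>e. p ` e) ` E) x = qform n E (x \<circ> p)"
proof -
  have inj: "inj_on p {0..<n}" using p by (rule bij_betw_imp_inj_on)
  have e: "edge_ind ((\<lambda>e. p ` e) ` E) (p i) (p j) = edge_ind E i j" if "i < n" "j < n" for i j
  proof -
    have "{p i, p j} \<in> (\<lambda>e. p ` e) ` E \<longleftrightarrow> {i, j} \<in> E"
    proof
      assume "{p i, p j} \<in> (\<lambda>e. p ` e) ` E"
      then obtain e where e: "e \<in> E" "p ` {i, j} = p ` e" by auto
      obtain u v where "e = {u, v}" "u \<in> {0..<n}" "v \<in> {0..<n}"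
        using E e(1) unfolding simple_graph_def by metis
      then have "e \<subseteq> {0..<n}" by simp
      then have "{i, j} = e"
        using inj_on_image_eq_iff[OF inj, of "{i, j}" e] that e(2) by auto
      then show "{i, j} \<in> E" using e by simp
    next
      assume "{i, j} \<in> E"
      then have "p ` {i, j} \<in> (\<lambda>e. p ` e) ` E" by blast
      then show "{p i, p j} \<in> (\<lambda>e. p ` e) ` E" by simp
    qed
    then show ?thesis by (simp add: edge_ind_def)
  qed
  have r: "(\<Sum>i\<in>{0..<n}. f i) = (\<Sum>i\<in>{0..<n}. f (p i))" for f :: "nat \<Rightarrow> real"
    using sum.reindex_bij_betw[OF p, of f] by simp
  have "qform n ((\<lambda>e. p ` e) ` E) x =
    (\<Sum>i\<in>{0..<n}. \<Sum>j\<in>{0..<n}. edge_ind ((\<lambda>e. p ` e) ` E) (p i) (p j) * (x (p i) * x (p j)))"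
    unfolding qform_def by (subst r, subst (2) r) simp
  also have "\<dots> = qform n E (x \<circ> p)"
    unfolding qform_def by (intro sum.cong refl) (auto simp: e)
  finally show ?thesis .
qed

lemma sqn_permute: "bij_betw p {0..<n} {0..<n} \<Longrightarrow> sqn n (x \<circ> p) = sqn n x"
  unfolding sqn_def comp_def by (rule sum.reindex_bij_betw)

text \<open>Transferring nonnegative test vectors suffices because the maximum is attained at one;
  this is what makes the radius monotone in the edge set.\<close>

lemma spec_rad_le_of_qform_transfer:
  assumes n: "n > 0"
    and "\<And>x. (\<forall>i. x i \<ge> 0) \<Longrightarrow> \<exists>y. qform n E x \<le> qform n E' y \<and> sqn n y = sqn n x"
  shows "spec_rad n E \<le> spec_rad n E'"
proof -
  obtain x where x: "\<forall>i. x i \<ge> 0" "\<exists>i<n. x i \<noteq> 0" "qform n E x = spec_rad n E * sqn n x"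
    using spec_rad_Rayleigh(1)[OF n] by blast
  obtain y where y: "qform n E x \<le> qform n E' y" "sqn n y = sqn n x"
    using assms(2)[OF x(1)] by blast
  have "sqn n x > 0"
    using x(2) sqn_nonneg[of n x] sqn_eq_0_iff[of n x] by fastforce
  moreover have "spec_rad n E * sqn n x \<le> spec_rad n E' * sqn n x"
    using spec_rad_Rayleigh(2)[OF n, of E' y] x(3) y by simp
  ultimately show ?thesis by simp
qed

lemma spec_rad_mono:
  assumes "n > 0" "E \<subseteq> E'"
  shows "spec_rad n E \<le> spec_rad n E'"
proof (rule spec_rad_le_of_qform_transfer[OF assms(1)])
  fix x :: "nat \<Rightarrow> real" assume x: "\<forall>i. x i \<ge> 0"
  have "qform n E x \<le> qform n E' x"
    unfolding qform_def using assms(2) x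
    by (intro sum_mono mult_right_mono) (auto simp: edge_ind_def)
  then show "\<exists>y. qform n E x \<le> qform n E' y \<and> sqn n y = sqn n x" by blast
qed

lemma spec_rad_graph_iso:
  assumes "n > 0" "simple_graph {0..<n} E" "graph_iso n E E'"
  shows "spec_rad n E' = spec_rad n E"
proof -
  obtain p where p: "bij_betw p {0..<n} {0..<n}" and E': "E' = (\<lambda>e. p ` e) ` E"
    using assms(3) unfolding graph_iso_def by blast
  let ?q = "inv_into {0..<n} p"
  have q: "bij_betw ?q {0..<n} {0..<n}" by (rule bij_betw_inv_into[OF p])
  show ?thesis
  proof (rule antisym)
    show "spec_rad n E' \<le> spec_rad n E"
    proof (rule spec_rad_le_of_qform_transfer[OF assms(1)])
      fix x :: "nat \<Rightarrow> real"
      show "\<exists>y. qform n E' x \<le> qform n E y \<and> sqn n y = sqn n x"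
        unfolding E' qform_permute[OF p assms(2)]
        by (intro exI[of _ "x \<circ> p"]) (simp add: sqn_permute[OF p])
    qed
    show "spec_rad n E \<le> spec_rad n E'"
    proof (rule spec_rad_le_of_qform_transfer[OF assms(1)])
      fix x :: "nat \<Rightarrow> real"
      have "qform n E' (x \<circ> ?q) = qform n E x"
        unfolding E' qform_permute[OF p assms(2)]
        using p by (intro qform_cong) (simp add: bij_betw_inv_into_left)
      then show "\<exists>y. qform n E x \<le> qform n E' y \<and> sqn n y = sqn n x"
        using sqn_permute[OF q, of x] by (intro exI[of _ "x \<circ> ?q"]) simp
    qed
  qed
qed

subsection \<open>Neighbourhoods and paths\<close>

definition nbh :: "nat set set \<Rightarrow> nat \<Rightarrow> nat set" where
  "nbh E v = {u. {v, u} \<in> E}"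

text \<open>Ordered pairs, so \<open>A\<close> and \<open>B\<close> may overlap; an edge inside the
  overlap then counts twice.\<close>

definition pairs :: "nat set set \<Rightarrow> nat set \<Rightarrow> nat set \<Rightarrow> (nat \<times> nat) set" where
  "pairs E A B = {(a, b). a \<in> A \<and> b \<in> B \<and> b \<in> nbh E a}"

definition is_path :: "nat set set \<Rightarrow> nat list \<Rightarrow> bool" where
  "is_path E xs \<longleftrightarrow> distinct xs \<and> successively (\<lambda>u v. {u, v} \<in> E) xs"

lemma nbh_sym: "u \<in> nbh E v \<longleftrightarrow> v \<in> nbh E u"
  by (simp add: nbh_def insert_commute)

lemma simple_graph_edgeD:
  assumes "simple_graph {0..<n} E" "{u, v} \<in> E"
  shows "u < n" "v < n" "u \<noteq> v"
  using assms unfolding simple_graph_def by (metis doubleton_eq_iff atLeastLessThan_iff)+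

lemma nbh_subset: "simple_graph {0..<n} E \<Longrightarrow> nbh E v \<subseteq> {0..<n}"
  using simple_graph_edgeD[of n E] by (auto simp: nbh_def)

lemma finite_nbh: "simple_graph {0..<n} E \<Longrightarrow> finite (nbh E v)"
  by (rule finite_subset[OF nbh_subset]) simp_all

lemma nbh_irrefl: "simple_graph {0..<n} E \<Longrightarrow> v \<notin> nbh E v"
  using simple_graph_edgeD(3)[of n E v v] by (auto simp: nbh_def)

lemma is_path_append:
  "xs \<noteq> [] \<Longrightarrow> is_path E (xs @ [a, b]) \<longleftrightarrow>
    is_path E xs \<and> a \<notin> set xs \<and> b \<notin> set xs \<and> a \<noteq> b \<and> a \<in> nbh E (last xs) \<and> b \<in> nbh E a"
  by (auto simp: is_path_def successively_append_iff nbh_def)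

lemma is_path_take: "is_path E xs \<Longrightarrow> is_path E (take m xs)"
  using successively_append_iff[of _ "take m xs" "drop m xs"] by (simp add: is_path_def)

text \<open>\<open>is_path\<close> accepts every singleton list, in the graph or not; from length 2
  on each vertex lies on an edge.\<close>

lemma is_path_in:
  assumes "simple_graph {0..<n} E" "is_path E xs" "length xs \<ge> 2"
  shows "set xs \<subseteq> {0..<n}"
  using assms(2,3)
proof (induction xs rule: induct_list012)
  case (3 x y zs)
  have xy: "{x, y} \<in> E" using 3 by (simp add: is_path_def)
  have p: "is_path E (y # zs)" using 3(3) by (auto simp: is_path_def)
  show ?case
  proof (cases zs)
    case Nil
    then show ?thesis using simple_graph_edgeD[OF assms(1) xy] by simp
  next
    case (Cons z zs')
    then show ?thesis using simple_graph_edgeD[OF assms(1) xy] 3(2)[OF p] by simp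
  qed
qed auto

subsection \<open>Embedding stars and paths greedily\<close>

lemma ex_not_in_smaller:
  assumes "finite U" "card U < card C"
  shows "\<exists>c\<in>C. c \<notin> U"
  by (meson assms card_mono linorder_not_less subsetI)

text \<open>Representatives are chosen one at a time: earlier choices and \<open>U\<close> together
  never exhaust a candidate set of this size.\<close>

lemma greedy_transversal:
  assumes "finite J" "finite U"
    and "\<And>j. j \<in> J \<Longrightarrow> card J + card U \<le> card (C j)"
  shows "\<exists>g. inj_on g J \<and> (\<forall>j\<in>J. g j \<in> C j \<and> g j \<notin> U)"
  using assms
proof (induction J rule: finite_induct)
  case (insert i J)
  have "\<exists>g. inj_on g J \<and> (\<forall>j\<in>J. g j \<in> C j \<and> g j \<notin> U)"
    using insert.prems insert.hyps by (intro insert.IH) force+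
  then obtain g where g: "inj_on g J" "\<forall>j\<in>J. g j \<in> C j \<and> g j \<notin> U" by blast
  have "card (g ` J \<union> U) \<le> card J + card U"
    by (meson card_Un_le card_image_le insert.hyps(1) add_le_mono1 order_trans)
  also have "\<dots> < card (C i)"
    using insert.prems(2)[of i] insert.hyps by simp
  finally obtain c where c: "c \<in> C i" "c \<notin> g ` J \<union> U"
    using ex_not_in_smaller[of "g ` J \<union> U" "C i"] insert.hyps(1) insert.prems(1) by auto
  show ?case
  proof (intro exI conjI)
    show "inj_on (g(i := c)) (insert i J)"
      using g c insert.hyps(2) by (auto simp: inj_on_def)
    show "\<forall>j\<in>insert i J. (g(i := c)) j \<in> C j \<and> (g(i := c)) j \<notin> U"
      using g c by auto
  qed
qed auto

text \<open>The degree bound is the order of the forest, so every star finds its leaves greedily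
  outside the path, the centres and the other leaves.\<close>

lemma has_F_if_path_and_centres:
  assumes E: "simple_graph {0..<n} E" and p: "is_path E xs" "length xs = l" and l: "l \<ge> 2"
    and C: "finite C" "card C \<ge> k" "C \<inter> set xs = {}" "C \<subseteq> {0..<n}"
    and deg: "\<And>c. c \<in> C \<Longrightarrow> card (nbh E c) \<ge> (k + 1) * l"
  shows "has_subgraph {0..<n} E (F_vert k l) (F_edges k l)"
proof -
  obtain C' where C': "C' \<subseteq> C" "card C' = k"
    using C(2) by (meson obtain_subset_with_card_n)
  have finC': "finite C'" using C' C(1) finite_subset by blast
  obtain c where c: "bij_betw c {0..<k} C'"
    using ex_bij_betw_nat_finite[OF finC'] C'(2) by blast
  \<comment> \<open>The labels of the star leaves: below \<open>k * l\<close> the multiples of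
    \<open>l\<close> are the centres, and from \<open>k * l\<close> on come the path
    vertices.\<close>
  define J where "J = {v. v < k * l \<and> v mod l \<noteq> 0}"
  define U where "U = set xs \<union> C'"
  have finJ: "finite J" and finU: "finite U" using finC' by (auto simp: J_def U_def)
  have divk: "v div l < k" if "v < k * l" for v
    using that by (simp add: less_mult_imp_div_less)
  \<comment> \<open>Together with \<open>cU\<close> this gives
    \<open>card J + card U \<le> k * l + l\<close>, exactly the degree bound that the greedy choice
    needs.\<close>
  have cJ: "card J + k \<le> k * l"
  proof -
    have "J \<inter> (\<lambda>i. i * l) ` {0..<k} = {}" by (auto simp: J_def)
    moreover have "card ((\<lambda>i. i * l) ` {0..<k}) = k"
      using l by (subst card_image) (auto simp: inj_on_def)
    moreover have "J \<union> (\<lambda>i. i * l) ` {0..<k} \<subseteq> {0..<k * l}"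
      using l by (auto simp: J_def)
    ultimately show ?thesis
      using card_mono[of "{0..<k * l}" "J \<union> (\<lambda>i. i * l) ` {0..<k}"]
        card_Un_disjoint[OF finJ, of "(\<lambda>i. i * l) ` {0..<k}"] by simp
  qed
  have cU: "card U \<le> l + k"
    unfolding U_def using card_Un_le[of "set xs" C'] card_length[of xs] p(2) C'(2) by linarith
  have cin: "c i \<in> C'" if "i < k" for i using c that by (auto simp: bij_betw_def)
  obtain g where g: "inj_on g J" "\<And>j. j \<in> J \<Longrightarrow> g j \<in> nbh E (c (j div l)) \<and> g j \<notin> U"
  proof -
    have "card J + card U \<le> card (nbh E (c (j div l)))" if "j \<in> J" for j
    proof -
      have "c (j div l) \<in> C" using that divk cin C'(1) by (auto simp: J_def)
      from deg[OF this] show ?thesis using cJ cU by simp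
    qed
    then show thesis using greedy_transversal[OF finJ finU, of "\<lambda>j. nbh E (c (j div l))"] that by blast
  qed
  define f where "f v = (if v \<ge> k * l then xs ! (v - k * l)
     else if v mod l = 0 then c (v div l) else g v)" for v
  have setxs: "set xs \<subseteq> {0..<n}" using is_path_in[OF E p(1)] p(2) l by simp
  have dx: "distinct xs" using p by (simp add: is_path_def)
  have f1: "f v \<in> set xs" if "v \<ge> k * l" "v < (k + 1) * l" for v
    using that p(2) by (auto simp: f_def)
  have f2: "f v \<in> C'" if "v < k * l" "v mod l = 0" for v
    using that cin divk by (auto simp: f_def)
  have f3: "f v \<notin> U" "f v \<in> {0..<n}" if "v \<in> J" for v
    using that g(2)[OF that] nbh_subset[OF E, of "c (v div l)"] by (auto simp: f_def J_def)
  have disj: "C' \<inter> set xs = {}" using C' C by blast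
  have "inj_on f (F_vert k l)"
  proof (rule inj_onI)
    fix u v assume uv: "u \<in> F_vert k l" "v \<in> F_vert k l" "f u = f v"
    have cases: "w \<in> J \<and> f w = g w \<and> f w \<notin> U \<or>
        w < k * l \<and> w mod l = 0 \<and> f w = c (w div l) \<and> f w \<in> C' \<or>
        k * l \<le> w \<and> f w = xs ! (w - k * l) \<and> f w \<in> set xs" if "w \<in> F_vert k l" for w
      using that f1[of w] f2[of w] f3[of w] by (auto simp: f_def J_def F_vert_def)
    consider "u \<in> J" "v \<in> J" "g u = g v"
      | "u < k * l" "u mod l = 0" "v < k * l" "v mod l = 0" "c (u div l) = c (v div l)"
      | "k * l \<le> u" "k * l \<le> v" "xs ! (u - k * l) = xs ! (v - k * l)"
      using cases[OF uv(1)] cases[OF uv(2)] uv(3) disj unfolding U_def by auto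
    then show "u = v"
    proof cases
      case 1
      then show ?thesis using g(1) by (simp add: inj_on_def)
    next
      case 2
      then have "u div l = v div l"
        using c divk by (metis atLeastLessThan_iff bij_betw_def inj_on_def le0)
      then show ?thesis using 2 by (metis div_mult_mod_eq)
    next
      case 3
      then have "u - k * l < length xs" "v - k * l < length xs"
        using uv p(2) by (auto simp: F_vert_def)
      then have "u - k * l = v - k * l" using 3 dx by (simp add: nth_eq_iff_index_eq)
      then show ?thesis using 3 by simp
    qed
  qed
  moreover have "f ` F_vert k l \<subseteq> {0..<n}"
  proof
    fix y assume "y \<in> f ` F_vert k l"
    then obtain v where v: "v < (k + 1) * l" "y = f v" by (auto simp: F_vert_def)
    consider "v \<ge> k * l" | "v < k * l" "v mod l = 0" | "v \<in> J" unfolding J_def by force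
    then show "y \<in> {0..<n}"
    proof cases
      case 1
      then show ?thesis using v f1[of v] setxs by blast
    next
      case 2
      then show ?thesis using v f2[of v] C' C(4) by auto
    next
      case 3
      then show ?thesis using v f3[of v] by auto
    qed
  qed
  moreover have "f ` e \<in> E" if "e \<in> F_edges k l" for e
  proof -
    from that consider i j where "e = {i * l, i * l + j}" "i < k" "1 \<le> j" "j < l"
      | j where "e = {k * l + j, k * l + j + 1}" "j + 1 < l"
      by (auto simp: F_edges_def)
    then show ?thesis
    proof cases
      case 1
      have "(i + 1) * l \<le> k * l" using 1 by (intro mult_le_mono1) simp
      then have lt: "i * l + j < k * l" using 1 by simp
      have J: "i * l + j \<in> J" using lt 1 by (simp add: J_def)
      have "f (i * l) = c i" using lt 1 by (simp add: f_def)
      moreover have "f (i * l + j) = g (i * l + j)" using lt 1 by (simp add: f_def)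
      moreover have "g (i * l + j) \<in> nbh E (c i)" using g(2)[OF J] 1 by simp
      ultimately show ?thesis using 1 by (simp add: nbh_def)
    next
      case 2
      have "{xs ! j, xs ! Suc j} \<in> E"
        using p 2(2) by (simp add: is_path_def successively_conv_nth)
      then show ?thesis using 2 by (simp add: f_def)
    qed
  qed
  ultimately show ?thesis unfolding has_subgraph_def by blast
qed

text \<open>The alternative in the assumption covers both disjoint \<open>A\<close>, \<open>B\<close> and, with a larger
  degree bound, arbitrary \<open>A\<close>, \<open>B\<close>.\<close>
lemma path_extend:
  assumes "is_path E xs" "xs \<noteq> []" "last xs \<in> B"
    and A: "\<And>a. a \<in> A \<Longrightarrow> card (nbh E a \<inter> B) \<ge> length xs + 2 * r"
    and B: "\<And>b. b \<in> B \<Longrightarrow> card (nbh E b \<inter> A) \<ge> q"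
    and q: "A \<inter> B = {} \<and> card (set xs \<inter> A) + r \<le> q \<or> length xs + 2 * r \<le> q"
  shows "\<exists>ys. is_path E (xs @ ys) \<and> length ys = 2 * r \<and> set ys \<subseteq> A \<union> B \<and>
           (A \<inter> B = {} \<longrightarrow> card (set ys \<inter> A) \<le> r)"
  using assms(1-3) A q
proof (induction r arbitrary: xs)
  case 0
  then show ?case by (intro exI[of _ "[]"]) auto
next
  case (Suc r)
  have "card (set xs \<inter> A) < q"
    using Suc.prems(5) card_mono[of "set xs" "set xs \<inter> A"] card_length[of xs] by auto
  also have "q \<le> card (nbh E (last xs) \<inter> A)" using B Suc.prems(3) by blast
  finally obtain a where a: "a \<in> nbh E (last xs) \<inter> A" "a \<notin> set xs \<inter> A"
    using ex_not_in_smaller[of "set xs \<inter> A"] by (metis List.finite_set finite_Int)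
  have "card (insert a (set xs)) \<le> 1 + length xs"
    using card_length[of "a # xs"] by simp
  also have "\<dots> < card (nbh E a \<inter> B)" using Suc.prems(4)[of a] a by simp
  finally obtain b where b: "b \<in> nbh E a \<inter> B" "b \<notin> insert a (set xs)"
    using ex_not_in_smaller[of "insert a (set xs)"] by (metis List.finite_set finite_insert)
  let ?xs = "xs @ [a, b]"
  have path: "is_path E ?xs"
    using Suc.prems(1,2) a b by (auto simp: is_path_append)
  have "card (set ?xs \<inter> A) \<le> card (set xs \<inter> A) + 1" if "A \<inter> B = {}"
  proof -
    have "set ?xs \<inter> A \<subseteq> insert a (set xs \<inter> A)" using b that by auto
    then have "card (set ?xs \<inter> A) \<le> card (insert a (set xs \<inter> A))" by (intro card_mono) auto
    then show ?thesis using card_insert_le_m1[of _ "set xs \<inter> A" a] by (simp add: card_insert_if split: if_splits)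
  qed
  then have q': "A \<inter> B = {} \<and> card (set ?xs \<inter> A) + r \<le> q \<or> length ?xs + 2 * r \<le> q"
    using Suc.prems(5) by force
  have "\<exists>ys. is_path E (?xs @ ys) \<and> length ys = 2 * r \<and> set ys \<subseteq> A \<union> B \<and>
           (A \<inter> B = {} \<longrightarrow> card (set ys \<inter> A) \<le> r)"
    using path b Suc.prems(4) q' by (intro Suc.IH) auto
  then obtain ys where ys: "is_path E (?xs @ ys)" "length ys = 2 * r" "set ys \<subseteq> A \<union> B"
      "A \<inter> B = {} \<longrightarrow> card (set ys \<inter> A) \<le> r" by blast
  have "card (set (a # b # ys) \<inter> A) \<le> Suc r" if "A \<inter> B = {}"
  proof -
    have "set (a # b # ys) \<inter> A \<subseteq> insert a (set ys \<inter> A)" using b that by auto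
    then have "card (set (a # b # ys) \<inter> A) \<le> card (insert a (set ys \<inter> A))" by (intro card_mono) auto
    then show ?thesis using ys(4) that by (simp add: card_insert_if split: if_splits)
  qed
  then show ?case
    using ys a b by (intro exI[of _ "a # b # ys"]) auto
qed

text \<open>Starting in \<open>B\<close> and extending \<open>l div 2\<close> times by a vertex of
  \<open>A\<close> and one of \<open>B\<close> gives \<open>1 + 2 * (l div 2)\<close> vertices,
  which is at least \<open>l\<close>; cutting back to \<open>l\<close> handles both parities. The
  start in \<open>B\<close> keeps the number of \<open>A\<close>-vertices down to
  \<open>l div 2\<close>.\<close>

lemma path_exists:
  assumes "b \<in> B"
    and A: "\<And>a. a \<in> A \<Longrightarrow> card (nbh E a \<inter> B) \<ge> l + 1"
    and B: "\<And>b. b \<in> B \<Longrightarrow> card (nbh E b \<inter> A) \<ge> q"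
    and q: "A \<inter> B = {} \<and> l div 2 \<le> q \<or> l + 1 \<le> q"
  shows "\<exists>xs. is_path E xs \<and> length xs = l \<and> (A \<inter> B = {} \<longrightarrow> card (set xs \<inter> A) \<le> l div 2)"
proof -
  have "\<exists>ys. is_path E ([b] @ ys) \<and> length ys = 2 * (l div 2) \<and> set ys \<subseteq> A \<union> B \<and>
           (A \<inter> B = {} \<longrightarrow> card (set ys \<inter> A) \<le> l div 2)"
  proof (rule path_extend)
    show "is_path E [b]" by (simp add: is_path_def)
    show "card (nbh E a \<inter> B) \<ge> length [b] + 2 * (l div 2)" if "a \<in> A" for a
      using A[OF that] by simp
    show "card (nbh E b \<inter> A) \<ge> q" if "b \<in> B" for b using B[OF that] .
    show "A \<inter> B = {} \<and> card (set [b] \<inter> A) + l div 2 \<le> q \<or> length [b] + 2 * (l div 2) \<le> q"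
    proof (cases "A \<inter> B = {}")
      case True
      then have "{b} \<inter> A = {}" using assms(1) by blast
      then show ?thesis using True q by auto
    next
      case False
      then show ?thesis using q by auto
    qed
  qed (use assms(1) in auto)
  then obtain ys where ys: "is_path E ([b] @ ys)" "length ys = 2 * (l div 2)"
    "A \<inter> B = {} \<longrightarrow> card (set ys \<inter> A) \<le> l div 2" by blast
  let ?xs = "take l ([b] @ ys)"
  have "card (set ?xs \<inter> A) \<le> l div 2" if "A \<inter> B = {}"
  proof -
    have "set ?xs \<inter> A \<subseteq> set ys \<inter> A" using assms(1) that set_take_subset[of l "[b] @ ys"] by auto
    then have "card (set ?xs \<inter> A) \<le> card (set ys \<inter> A)" by (intro card_mono) auto
    then show ?thesis using ys(3) that by simp
  qed
  moreover have "length ?xs = l" using ys(2) by simp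
  moreover have "is_path E ?xs" using is_path_take[OF ys(1)] .
  ultimately show ?thesis by blast
qed

text \<open>\<open>A\<close> has at least \<open>k + l div 2\<close> vertices and the alternating
  path consumes at most \<open>l div 2\<close> of them, so \<open>k\<close> remain as star
  centres.\<close>

lemma has_F_if_dense_bipartite:
  assumes E: "simple_graph {0..<n} E" and l: "l \<ge> 2" and k: "k \<ge> 1"
    and AB: "A \<inter> B = {}" "b0 \<in> B" "A \<subseteq> {0..<n}"
    and A: "\<And>a. a \<in> A \<Longrightarrow> card (nbh E a \<inter> B) \<ge> (k + 1) * l"
    and B: "\<And>b. b \<in> B \<Longrightarrow> card (nbh E b \<inter> A) \<ge> k + l div 2"
  shows "has_subgraph {0..<n} E (F_vert k l) (F_edges k l)"
proof -
  have "l + 1 \<le> (k + 1) * l" using k l by (cases k) auto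
  then obtain xs where xs: "is_path E xs" "length xs = l" "card (set xs \<inter> A) \<le> l div 2"
    using path_exists[of b0 B A l E "k + l div 2"] AB A B by (metis le_trans le_add2)
  have finA: "finite A" using AB(3) finite_subset by blast
  have "k + l div 2 \<le> card A"
    using B[OF AB(2)] card_mono[OF finA, of "nbh E b0 \<inter> A"] by simp
  then have "card (A - set xs) \<ge> k"
    using xs(3) card_Diff_subset_Int[of A "set xs"] by (simp add: Int_commute)
  moreover have "card (nbh E c) \<ge> (k + 1) * l" if "c \<in> A" for c
    using A[OF that] card_mono[OF finite_nbh[OF E], of "nbh E c \<inter> B" c] by fastforce
  ultimately show ?thesis
    using has_F_if_path_and_centres[OF E xs(1,2) l, of "A - set xs" k] finA AB(3) by blast
qed

subsection \<open>Counting edges by peeling off vertices of small degree\<close>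

lemma pairs_swap: "card (pairs E A B) = card (pairs E B A)"
proof -
  have "pairs E B A = prod.swap ` pairs E A B"
    unfolding pairs_def using nbh_sym by (auto simp: image_iff)
  then show ?thesis by (simp add: card_image)
qed

lemma card_pairs:
  assumes "finite A" "finite B"
  shows "card (pairs E A B) = (\<Sum>a\<in>A. card (nbh E a \<inter> B))"
proof -
  have "pairs E A B = Sigma A (\<lambda>a. nbh E a \<inter> B)" by (auto simp: pairs_def)
  then show ?thesis using assms by (simp add: card_SigmaI)
qed

text \<open>Deleting a vertex of \<open>A\<close> with at most \<open>p\<close> partners, or one of
  \<open>B\<close> with at most \<open>q\<close>, costs at most that many pairs. If neither exists
  and \<open>B\<close> is nonempty, what remains is a core excluded by hypothesis. A vertex in both
  sets is deleted from one side at a time.\<close>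

lemma peeling_bound:
  assumes "finite A" "finite B"
    and no_core: "\<And>A' B'. \<lbrakk>A' \<subseteq> A; B' \<subseteq> B; B' \<noteq> {}; \<And>a. a \<in> A' \<Longrightarrow> card (nbh E a \<inter> B') \<ge> Suc p;
        \<And>b. b \<in> B' \<Longrightarrow> card (nbh E b \<inter> A') \<ge> Suc q\<rbrakk> \<Longrightarrow> False"
  shows "card (pairs E A B) \<le> p * card A + q * card B"
  using assms
proof (induction "card A + card B" arbitrary: A B rule: less_induct)
  case less
  consider (a) a where "a \<in> A" "card (nbh E a \<inter> B) \<le> p"
    | (b) b where "b \<in> B" "card (nbh E b \<inter> A) \<le> q" | (e) "B = {}"
  proof -
    assume *: "\<And>a. a \<in> A \<Longrightarrow> card (nbh E a \<inter> B) \<le> p \<Longrightarrow> thesis"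
      "\<And>b. b \<in> B \<Longrightarrow> card (nbh E b \<inter> A) \<le> q \<Longrightarrow> thesis" "B = {} \<Longrightarrow> thesis"
    show thesis
    proof (rule ccontr)
      assume "\<not> thesis"
      then have "B \<noteq> {}" "\<And>a. a \<in> A \<Longrightarrow> card (nbh E a \<inter> B) \<ge> Suc p"
        "\<And>b. b \<in> B \<Longrightarrow> card (nbh E b \<inter> A) \<ge> Suc q" using * by (meson not_less_eq_eq)+
      then show False using less.prems(3)[of A B] by blast
    qed
  qed
  then show ?case
  proof cases
    case a
    let ?A = "A - {a}"
    have lt: "card ?A < card A" by (rule card_Diff1_less[OF less.prems(1) a(1)])
    then have "card (pairs E ?A B) \<le> p * card ?A + q * card B"
      using less.prems a(1) by (intro less.hyps) (simp, simp, simp, meson Diff_subset subset_trans)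
    moreover have "card (pairs E A B) = card (nbh E a \<inter> B) + card (pairs E ?A B)"
      using less.prems(1,2) a(1) by (simp add: card_pairs sum.remove)
    moreover have "card A = Suc (card ?A)" using card_Suc_Diff1[OF less.prems(1) a(1)] by simp
    ultimately show ?thesis using a(2) by simp
  next
    case b
    let ?B = "B - {b}"
    have lt: "card ?B < card B" by (rule card_Diff1_less[OF less.prems(2) b(1)])
    then have "card (pairs E A ?B) \<le> p * card A + q * card ?B"
      using less.prems b(1) by (intro less.hyps) (simp, simp, simp, meson Diff_subset subset_trans)
    then have "card (pairs E ?B A) \<le> p * card A + q * card ?B" by (simp add: pairs_swap)
    moreover have "card (pairs E B A) = card (nbh E b \<inter> A) + card (pairs E ?B A)"
      using less.prems(1,2) b(1) by (simp add: card_pairs sum.remove)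
    moreover have "card B = Suc (card ?B)" using card_Suc_Diff1[OF less.prems(2) b(1)] by simp
    ultimately show ?thesis using b(2) by (simp add: pairs_swap[of E A B])
  next
    case e
    then show ?thesis by (simp add: pairs_def)
  qed
qed

text \<open>The coefficient of \<open>B\<close> is the sharp one: a remainder in which every vertex
  of \<open>B\<close> keeps one partner more would contain the forest. The large coefficient falls
  on \<open>A\<close>, which is small in the applications.\<close>

lemma pairs_bound_F_free:
  assumes E: "simple_graph {0..<n} E" and l: "l \<ge> 2" and k: "k \<ge> 1"
    and free: "F_free (F_vert k l) (F_edges k l) {0..<n} E"
    and AB: "A \<subseteq> {0..<n}" "B \<subseteq> {0..<n}" "A \<inter> B = {}"
  shows "card (pairs E A B) \<le> (k + 1) * l * card A + (k + l div 2 - 1) * card B"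
proof (rule peeling_bound)
  show "finite A" "finite B"
    using finite_subset[OF AB(1)] finite_subset[OF AB(2)] by simp_all
  fix A' B' assume *: "A' \<subseteq> A" "B' \<subseteq> B" "B' \<noteq> {}"
    "\<And>a. a \<in> A' \<Longrightarrow> card (nbh E a \<inter> B') \<ge> Suc ((k + 1) * l)"
    "\<And>b. b \<in> B' \<Longrightarrow> card (nbh E b \<inter> A') \<ge> Suc (k + l div 2 - 1)"
  obtain b0 where "b0 \<in> B'" using *(3) by blast
  then have "has_subgraph {0..<n} E (F_vert k l) (F_edges k l)"
    using * AB k by (intro has_F_if_dense_bipartite[OF E l k, of A' B' b0]) (force+)
  then show False using free by (simp add: F_free_def)
qed

text \<open>The first bound tolerates overlapping sets and is used for crude counts; the second, for
  disjoint sets, has the sharp coefficient on which the walk count depends.\<close>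

lemma pairs_bound_path_free:
  assumes free: "\<nexists>xs. is_path E xs \<and> length xs = l"
    and AB: "finite A" "finite B"
  shows "card (pairs E A B) \<le> l * card A + l * card B"
    and "A \<inter> B = {} \<Longrightarrow> l \<ge> 2 \<Longrightarrow> card (pairs E A B) \<le> l * card A + (l div 2 - 1) * card B"
proof -
  show "card (pairs E A B) \<le> l * card A + l * card B"
  proof (rule peeling_bound[OF AB])
    fix A' B' assume *: "A' \<subseteq> A" "B' \<subseteq> B" "B' \<noteq> {}"
      "\<And>a. a \<in> A' \<Longrightarrow> card (nbh E a \<inter> B') \<ge> Suc l"
      "\<And>b. b \<in> B' \<Longrightarrow> card (nbh E b \<inter> A') \<ge> Suc l"
    obtain b0 where "b0 \<in> B'" using *(3) by blast
    then show False using path_exists[of b0 B' A' l E "Suc l"] * free by auto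
  qed
  assume d: "A \<inter> B = {}" and l: "l \<ge> 2"
  show "card (pairs E A B) \<le> l * card A + (l div 2 - 1) * card B"
  proof (rule peeling_bound[OF AB])
    fix A' B' assume *: "A' \<subseteq> A" "B' \<subseteq> B" "B' \<noteq> {}"
      "\<And>a. a \<in> A' \<Longrightarrow> card (nbh E a \<inter> B') \<ge> Suc l"
      "\<And>b. b \<in> B' \<Longrightarrow> card (nbh E b \<inter> A') \<ge> Suc (l div 2 - 1)"
    obtain b0 where "b0 \<in> B'" using *(3) by blast
    moreover have "A' \<inter> B' = {}" using * d by blast
    ultimately show False using path_exists[of b0 B' A' l E "Suc (l div 2 - 1)"] * free l by auto
  qed
qed

subsection \<open>The extremal graphs\<close>

text \<open>\<open>S_graph\<close> with an arbitrary set in place of the initial segment, so that a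
  core found inside a given graph needs no relabelling.\<close>

definition full_join :: "nat \<Rightarrow> nat set \<Rightarrow> nat set set" where
  "full_join n L = {{u, v} | u v. u < n \<and> v < n \<and> u \<noteq> v \<and> (u \<in> L \<or> v \<in> L)}"

lemma S_graph_eq: "S_graph n h = full_join n {0..<h}"
  by (simp add: S_graph_def full_join_def)

lemma in_full_join: "{u, v} \<in> full_join n L \<longleftrightarrow> u < n \<and> v < n \<and> u \<noteq> v \<and> (u \<in> L \<or> v \<in> L)"
  by (auto simp: full_join_def doubleton_eq_iff)

lemma simple_full_join:
  assumes "T = {} \<or> (\<exists>a b. T = {{a, b}} \<and> a < n \<and> b < n \<and> a \<noteq> b)"
  shows "simple_graph {0..<n} (full_join n L \<union> T)"
  unfolding simple_graph_def
proof (intro conjI ballI)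
  fix e assume "e \<in> full_join n L \<union> T"
  then consider "e \<in> full_join n L" | "e \<in> T" by blast
  then show "\<exists>u v. e = {u, v} \<and> u \<noteq> v \<and> u \<in> {0..<n} \<and> v \<in> {0..<n}"
  proof cases
    case 1
    then obtain u v where "e = {u, v}" "u < n" "v < n" "u \<noteq> v" unfolding full_join_def by auto
    then show ?thesis by (intro exI[of _ u] exI[of _ v]) simp
  next
    case 2
    then obtain a b where "e = {a, b}" "a < n" "b < n" "a \<noteq> b" using assms by auto
    then show ?thesis by (intro exI[of _ a] exI[of _ b]) simp
  qed
qed simp

text \<open>Even after deleting one edge (for odd \<open>l\<close>), the forbidden forest has a matching with
  \<open>k + l div 2\<close> edges, so it has no smaller vertex cover.\<close>
lemma no_small_cover:
  assumes inj: "inj_on f (F_vert k l)" and l: "l \<ge> 3"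
    and cov: "\<And>e. e \<in> F_edges k l \<Longrightarrow> f ` e \<inter> C \<noteq> {} \<or> f ` e = X"
    and C: "finite C" "card C < k + l div 2"
    and X: "odd l \<or> (\<forall>e\<in>F_edges k l. f ` e \<noteq> X)"
  shows False
proof -
  \<comment> \<open>The exempt image \<open>X\<close> must not be a matching edge. If the matching
    starting at the first path vertex would use it, the matching is shifted by one; the shift fits
    because this happens only for odd \<open>l\<close>.\<close>
  define o1 :: nat where "o1 = (if \<exists>j<l div 2. f ` {k * l + 2 * j, k * l + 2 * j + 1} = X then 1 else 0)"
  \<comment> \<open>In a star the clash with \<open>X\<close> is avoided by switching from the first
    leaf to the second.\<close>
  define s :: "nat \<Rightarrow> nat" where "s i = (if f ` {i * l, i * l + 1} = X then 2 else 1)" for i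
  define e where "e i = (if i < k then {i * l, i * l + s i}
     else {k * l + 2 * (i - k) + o1, k * l + 2 * (i - k) + o1 + 1})" for i
  let ?m = "k + l div 2"
  have star_lt: "i * l + j < k * l" if "i < k" "j < l" for i j
  proof -
    have "(i + 1) * l \<le> k * l" using that by (intro mult_le_mono1) simp
    then show ?thesis using that by simp
  qed
  have s: "1 \<le> s i" "s i < l" for i using l by (auto simp: s_def)
  have Fin: "{i * l, i * l + j} \<in> F_edges k l" if "i < k" "1 \<le> j" "j < l" for i j
    using that by (auto simp: F_edges_def)
  have Fin2: "{k * l + j, k * l + j + 1} \<in> F_edges k l" if "j + 1 < l" for j
    using that by (auto simp: F_edges_def)
  have o1: "o1 = 0 \<or> (o1 = 1 \<and> odd l)"
  proof (cases "o1 = 0")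
    case False
    then obtain j where j: "j < l div 2" "f ` {k * l + 2 * j, k * l + 2 * j + 1} = X"
      by (auto simp: o1_def split: if_splits)
    have "2 * j + 1 < l" using j(1) by linarith
    then show ?thesis using Fin2[of "2 * j"] j(2) X False by (auto simp: o1_def split: if_splits)
  qed simp
  have plt: "2 * (i - k) + o1 + 1 < l" if "k \<le> i" "i < ?m" for i
  proof -
    have "i - k + 1 \<le> l div 2" using that by linarith
    then have "2 * (i - k) + 2 \<le> 2 * (l div 2)" by linarith
    then show ?thesis using o1 by (elim disjE) (auto elim: oddE)
  qed
  have eF: "e i \<in> F_edges k l" if "i < ?m" for i
  proof (cases "i < k")
    case True
    then show ?thesis using Fin[of i "s i"] s by (simp add: e_def)
  next
    case False
    then show ?thesis using Fin2[of "2 * (i - k) + o1"] plt[of i] that by (simp add: e_def add.assoc)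
  qed
  have FV: "a \<subseteq> F_vert k l" if "a \<in> F_edges k l" for a
    using that star_lt by (fastforce simp: F_edges_def F_vert_def)
  have img: "f ` a = f ` b \<longleftrightarrow> a = b" if "a \<in> F_edges k l" "b \<in> F_edges k l" for a b
    using inj_on_image_eq_iff[OF inj FV[OF that(1)] FV[OF that(2)]] .
  have eX: "f ` e i \<noteq> X" if i: "i < ?m" for i
  proof (cases "i < k")
    case True
    have "f ` {i * l, i * l + 2} \<noteq> X" if "f ` {i * l, i * l + 1} = X"
      using img[OF Fin[of i 2] Fin[of i 1]] True l that by (auto simp: doubleton_eq_iff)
    then show ?thesis using True by (auto simp: e_def s_def)
  next
    case False
    then have i': "i - k < l div 2" using i by linarith
    show ?thesis
    proof (cases "o1 = 0")
      case True
      then show ?thesis using i' False by (auto simp: e_def o1_def split: if_splits)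
    next
      case o: False
      then obtain j where j: "j < l div 2" "f ` {k * l + 2 * j, k * l + 2 * j + 1} = X"
        by (auto simp: o1_def split: if_splits)
      have "2 * j + 1 < l" using j(1) by linarith
      then have "{k * l + 2 * j, k * l + 2 * j + 1} \<in> F_edges k l" using Fin2[of "2 * j"] by simp
      moreover have "e i \<noteq> {k * l + 2 * j, k * l + 2 * j + 1}"
        using False o1 o by (auto simp: e_def doubleton_eq_iff) presburger+
      ultimately show ?thesis using img[OF eF[OF i]] j(2) by metis
    qed
  qed
  have "\<exists>v. v \<in> e i \<and> f v \<in> C" if "i < ?m" for i
    using cov[OF eF[OF that]] eX[OF that] by blast
  then obtain g where g: "\<And>i. i < ?m \<Longrightarrow> g i \<in> e i \<and> f (g i) \<in> C" by metis
  \<comment> \<open>Recovers the number of a matching edge from either endpoint; this is what makes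
    the chosen edges disjoint.\<close>
  define idx where "idx v = (if v < k * l then v div l else k + (v - k * l - o1) div 2)" for v
  have idx: "idx v = i" if "v \<in> e i" "i < ?m" for v i
  proof (cases "i < k")
    case True
    then have "v = i * l + 0 \<or> v = i * l + s i" using that by (simp add: e_def)
    then obtain j where "v = i * l + j" "j < l" using s(2)[of i] l by (metis not_numeral_le_zero gr0I)
    then show ?thesis using star_lt[OF True, of j] l by (simp add: idx_def)
  next
    case False
    then show ?thesis using that by (auto simp: idx_def e_def)
  qed
  have "inj_on (f \<circ> g) {0..<?m}"
  proof (rule inj_onI)
    fix i j assume ij: "i \<in> {0..<?m}" "j \<in> {0..<?m}" "(f \<circ> g) i = (f \<circ> g) j"
    have "g i \<in> F_vert k l" "g j \<in> F_vert k l"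
      using ij(1,2) g FV eF by (meson atLeastLessThan_iff subsetD)+
    then have "g i = g j" using inj ij(3) by (simp add: inj_on_def)
    moreover have "idx (g i) = i" "idx (g j) = j" using idx g ij(1,2) by simp_all
    ultimately show "i = j" by metis
  qed
  moreover have "(f \<circ> g) ` {0..<?m} \<subseteq> C" using g by auto
  ultimately have "?m \<le> card C" using card_inj_on_le[of "f \<circ> g" "{0..<?m}" C] C(1) by simp
  then show False using C(2) by simp
qed

text \<open>Every edge of the join meets \<open>L\<close>, so a copy of the forest would be covered
  by \<open>L\<close> except for at most one edge, against the matching of size
  \<open>card L + 1\<close>.\<close>

lemma full_join_F_free:
  assumes "l \<ge> 4" "k \<ge> 1" "finite L" "card L = k + l div 2 - 1"
    and T: "T = {} \<or> odd l \<and> (\<exists>e. T = {e})"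
  shows "F_free (F_vert k l) (F_edges k l) {0..<n} (full_join n L \<union> T)"
  unfolding F_free_def has_subgraph_def
proof
  assume "\<exists>f. inj_on f (F_vert k l) \<and> f ` F_vert k l \<subseteq> {0..<n} \<and>
    (\<forall>e\<in>F_edges k l. f ` e \<in> full_join n L \<union> T)"
  then obtain f where f: "inj_on f (F_vert k l)"
    "\<And>e. e \<in> F_edges k l \<Longrightarrow> f ` e \<in> full_join n L \<union> T" by blast
  \<comment> \<open>Without an extra edge \<open>X\<close> is the empty set, which is never the
    image of an edge, so the exemption is void.\<close>
  define X where "X = (if T = {} then {} else THE e. T = {e})"
  have TX: "T \<subseteq> {X}" using T by (auto simp: X_def)
  have nonempty: "e \<noteq> {}" if "e \<in> F_edges k l" for e using that by (auto simp: F_edges_def)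
  have meet: "e \<inter> L \<noteq> {}" if "e \<in> full_join n L" for e using that by (auto simp: full_join_def)
  show False
  proof (rule no_small_cover[OF f(1), of L X])
    show "f ` e \<inter> L \<noteq> {} \<or> f ` e = X" if "e \<in> F_edges k l" for e
      using f(2)[OF that] meet TX by blast
    show "odd l \<or> (\<forall>e\<in>F_edges k l. f ` e \<noteq> X)"
      using T nonempty by (auto simp: X_def)
  qed (use assms in auto)
qed

section \<open>Isomorphic copies of the extremal graphs\<close>

lemma permuted_full_join:
  assumes p: "bij_betw p {0..<n} {0..<n}" and L: "L \<subseteq> {0..<n}"
  shows "(\<lambda>e. p ` e) ` full_join n L = full_join n (p ` L)"
proof -
  have inj: "inj_on p {0..<n}" and im: "p ` {0..<n} = {0..<n}" using p by (auto simp: bij_betw_def)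
  have plt: "p u < n" if "u < n" for u using im that by force
  have peq: "p u = p v \<longleftrightarrow> u = v" if "u < n" "v < n" for u v
    using inj_on_eq_iff[OF inj] that by simp
  show ?thesis
  proof (intro equalityI subsetI)
    fix e assume "e \<in> (\<lambda>e. p ` e) ` full_join n L"
    then obtain u v where uv: "e = p ` {u, v}" "u < n" "v < n" "u \<noteq> v" "u \<in> L \<or> v \<in> L"
      by (auto simp: full_join_def)
    then have "{p u, p v} \<in> full_join n (p ` L)"
      unfolding in_full_join using plt peq by auto
    then show "e \<in> full_join n (p ` L)" using uv(1) by simp
  next
    fix e assume "e \<in> full_join n (p ` L)"
    then obtain u v where uv: "e = {u, v}" "u < n" "v < n" "u \<noteq> v" "u \<in> p ` L \<or> v \<in> p ` L"
      by (auto simp: full_join_def)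
    obtain u' v' where u'v': "u' < n" "u = p u'" "v' < n" "v = p v'"
    proof -
      have "u \<in> p ` {0..<n}" "v \<in> p ` {0..<n}" using im uv(2,3) by simp_all
      then show thesis using that by auto
    qed
    have "u' \<in> L \<or> v' \<in> L"
      using uv(5) inj_on_image_mem_iff[OF inj _ L] u'v' by auto
    then have "{u', v'} \<in> full_join n L"
      unfolding in_full_join using u'v' uv(4) by auto
    moreover have "e = p ` {u', v'}" using uv(1) u'v' by simp
    ultimately show "e \<in> (\<lambda>e. p ` e) ` full_join n L" by blast
  qed
qed

lemma iso_S_graph:
  assumes "L \<subseteq> {0..<n}" "card L = h"
  shows "graph_iso n (S_graph n h) (full_join n L)"
proof -
  have finL: "finite L" using finite_subset[OF assms(1)] by simp
  have hn: "h \<le> n" using card_mono[OF _ assms(1)] assms(2) by simp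
  obtain p where p: "bij_betw p {0..<h} L"
    using finite_same_card_bij[of "{0..<h}" L] finL assms by auto
  obtain q where q: "bij_betw q {h..<n} ({0..<n} - L)"
    using finite_same_card_bij[of "{h..<n}" "{0..<n} - L"] card_Diff_subset[OF finL assms(1)] assms(2)
    by auto
  let ?r = "\<lambda>v. if v \<in> {0..<h} then p v else q v"
  have "bij_betw ?r ({0..<h} \<union> {h..<n}) (L \<union> ({0..<n} - L))"
    by (rule bij_betw_disjoint_Un[OF p q]) auto
  moreover have "{0..<h} \<union> {h..<n} = {0..<n}" "L \<union> ({0..<n} - L) = {0..<n}"
    using hn assms(1) by auto
  ultimately have r: "bij_betw ?r {0..<n} {0..<n}" by simp
  have "?r ` {0..<h} = L" using p by (auto simp: bij_betw_def)
  then show ?thesis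
    unfolding graph_iso_def S_graph_eq
    using permuted_full_join[OF r, of "{0..<h}"] hn r by (intro exI[of _ ?r]) auto
qed

lemma iso_S_plus_graph:
  assumes "L \<subseteq> {0..<n}" "card L = h" "a < n" "b < n" "a \<noteq> b" "a \<notin> L" "b \<notin> L"
  shows "graph_iso n (S_plus_graph n h) (full_join n L \<union> {{a, b}})"
proof -
  have finL: "finite L" using finite_subset[OF assms(1)] by simp
  have sub: "L \<union> {a, b} \<subseteq> {0..<n}" using assms by auto
  have c: "card (L \<union> {a, b}) = h + 2" using assms finL by simp
  have hn: "h + 2 \<le> n" using card_mono[OF _ sub] c by simp
  obtain p where p: "bij_betw p {0..<h} L"
    using finite_same_card_bij[of "{0..<h}" L] finL assms by auto
  obtain q where q: "bij_betw q {h+2..<n} ({0..<n} - (L \<union> {a, b}))"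
    using finite_same_card_bij[of "{h+2..<n}" "{0..<n} - (L \<union> {a, b})"]
      card_Diff_subset[OF _ sub] c finL by auto
  let ?s = "\<lambda>v. if v = h then a else b"
  have s: "bij_betw ?s {h, h+1} {a, b}" using assms(5) by (auto simp: bij_betw_def inj_on_def)
  have ps: "bij_betw (\<lambda>v. if v \<in> {0..<h} then p v else ?s v) ({0..<h} \<union> {h, h+1}) (L \<union> {a, b})"
    by (rule bij_betw_disjoint_Un[OF p s]) (use assms in auto)
  let ?r = "\<lambda>v. if v \<in> {0..<h} \<union> {h, h+1} then (if v \<in> {0..<h} then p v else ?s v) else q v"
  have "bij_betw ?r (({0..<h} \<union> {h, h+1}) \<union> {h+2..<n}) ((L \<union> {a, b}) \<union> ({0..<n} - (L \<union> {a, b})))"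
    by (rule bij_betw_disjoint_Un[OF ps q]) auto
  moreover have "({0..<h} \<union> {h, h+1}) \<union> {h+2..<n} = {0..<n}"
    "(L \<union> {a, b}) \<union> ({0..<n} - (L \<union> {a, b})) = {0..<n}"
    using hn sub by auto
  ultimately have r: "bij_betw ?r {0..<n} {0..<n}" by simp
  have "?r ` {0..<h} = p ` {0..<h}" by (intro image_cong) auto
  then have "?r ` {0..<h} = L" using p by (simp add: bij_betw_def)
  then have "(\<lambda>e. ?r ` e) ` full_join n {0..<h} = full_join n L"
    using permuted_full_join[OF r, of "{0..<h}"] hn by simp
  moreover have "?r ` {h, h+1} = {a, b}" by auto
  ultimately have "full_join n L \<union> {{a, b}} = (\<lambda>e. ?r ` e) ` S_plus_graph n h"
    unfolding S_plus_graph_def S_graph_eq image_Un by simp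
  then show ?thesis unfolding graph_iso_def using r by blast
qed

lemma S_graph_iso_imp:
  assumes "graph_iso n (S_graph n h) E" "h \<le> n"
  shows "\<exists>L \<subseteq> {0..<n}. card L = h \<and> E = full_join n L"
proof -
  obtain p where p: "bij_betw p {0..<n} {0..<n}" "E = (\<lambda>e. p ` e) ` full_join n {0..<h}"
    using assms(1) by (auto simp: graph_iso_def S_graph_eq)
  have sub: "{0..<h} \<subseteq> {0..<n}" using assms(2) by simp
  have "inj_on p {0..<h}" using inj_on_subset[OF bij_betw_imp_inj_on[OF p(1)] sub] .
  then have "card (p ` {0..<h}) = h" by (simp add: card_image)
  moreover have "p ` {0..<h} \<subseteq> {0..<n}" using p(1) image_mono[OF sub, of p] by (simp add: bij_betw_def)
  ultimately show ?thesis using permuted_full_join[OF p(1) sub] p(2) by blast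
qed

text \<open>The position of the extra edge is forgotten, since freeness of the forest uses only that
  there is one.\<close>

lemma S_plus_graph_iso_imp:
  assumes "graph_iso n (S_plus_graph n h) E" "h + 2 \<le> n"
  shows "\<exists>L \<subseteq> {0..<n}. \<exists>e. card L = h \<and> E = full_join n L \<union> {e}"
proof -
  obtain p where p: "bij_betw p {0..<n} {0..<n}"
      "E = (\<lambda>e. p ` e) ` full_join n {0..<h} \<union> {p ` {h, h + 1}}"
    using assms(1) by (auto simp: graph_iso_def S_graph_eq S_plus_graph_def)
  have "graph_iso n (S_graph n h) ((\<lambda>e. p ` e) ` full_join n {0..<h})"
    unfolding graph_iso_def S_graph_eq using p(1) by blast
  from S_graph_iso_imp[OF this] assms(2)
  obtain L where L: "L \<subseteq> {0..<n}" "card L = h"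
    "(\<lambda>e. p ` e) ` full_join n {0..<h} = full_join n L" by auto
  have "E = full_join n L \<union> {p ` {h, h + 1}}" using p(2) unfolding L(3) .
  with L(1,2) show ?thesis by metis
qed

section \<open>Edges off the core create the forest\<close>

text \<open>The core has \<open>k + l div 2 - 1\<close> vertices. A path that uses at most
  \<open>l div 2 - 1\<close> of them leaves \<open>k\<close> centres; \<open>xs\<close> is the
  initial segment in which the saving over an alternating path is made.\<close>

lemma path_through_core_not_F_free:
  assumes E: "simple_graph {0..<n} E" and l: "l \<ge> 4"
    and free: "F_free (F_vert k l) (F_edges k l) {0..<n} E"
    and L: "L \<subseteq> {0..<n}" "card L = k + l div 2 - 1"
    and B: "B \<inter> L = {}" "\<And>b. b \<in> B \<Longrightarrow> L \<subseteq> nbh E b" "card B \<ge> (k + 1) * l" "finite B"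
    and xs: "is_path E xs" "xs \<noteq> []" "last xs \<in> B" "length xs + 2 * r = l"
      "card (set xs \<inter> L) + r + 1 \<le> l div 2"
  shows False
proof -
  have finL: "finite L" using finite_subset[OF L(1)] by simp
  have Bn: "B \<subseteq> nbh E a" if "a \<in> L" for a using B(2) that nbh_sym by blast
  have deg: "card (nbh E a) \<ge> (k + 1) * l" if "a \<in> L" for a
    using card_mono[OF finite_nbh[OF E] Bn[OF that]] B(3) by linarith
  have "\<exists>ys. is_path E (xs @ ys) \<and> length ys = 2 * r \<and> set ys \<subseteq> L \<union> B \<and>
           (L \<inter> B = {} \<longrightarrow> card (set ys \<inter> L) \<le> r)"
  proof (rule path_extend[OF xs(1-3), where q = "card L"])
    show "card (nbh E a \<inter> B) \<ge> length xs + 2 * r" if "a \<in> L" for a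
      using Bn[OF that] B(3) xs(4) by (simp add: Int_absorb1 trans_le_add1)
    show "card (nbh E b \<inter> L) \<ge> card L" if "b \<in> B" for b
      using B(2)[OF that] by (simp add: Int_absorb1)
    show "L \<inter> B = {} \<and> card (set xs \<inter> L) + r \<le> card L \<or> length xs + 2 * r \<le> card L"
      using B(1) L(2) xs(5) by auto
  qed
  then obtain ys where ys: "is_path E (xs @ ys)" "length ys = 2 * r" "card (set ys \<inter> L) \<le> r"
    using B(1) by blast
  have "set (xs @ ys) \<inter> L = set xs \<inter> L \<union> set ys \<inter> L" by auto
  then have "card (set (xs @ ys) \<inter> L) \<le> card (set xs \<inter> L) + r"
    using card_Un_le[of "set xs \<inter> L" "set ys \<inter> L"] ys(3) by simp
  moreover have "card (L - set (xs @ ys)) = card L - card (L \<inter> set (xs @ ys))"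
    using finL by (intro card_Diff_subset_Int) auto
  ultimately have "card (L - set (xs @ ys)) \<ge> k"
    using L(2) xs(5) by (simp only: Int_commute[of L])
  then have "has_subgraph {0..<n} E (F_vert k l) (F_edges k l)"
    using ys xs(4) l finL deg L(1)
    by (intro has_F_if_path_and_centres[OF E ys(1), of l "L - set (xs @ ys)"]) auto
  then show False using free by (simp add: F_free_def)
qed

text \<open>For even \<open>l\<close> a single edge off the core saves a core vertex. For odd
  \<open>l\<close> parity defeats one edge, but two edges save one: consecutively if they share a
  vertex, otherwise joined through a core vertex.\<close>

lemma edges_off_core:
  assumes E: "simple_graph {0..<n} E" and l: "l \<ge> 4"
    and free: "F_free (F_vert k l) (F_edges k l) {0..<n} E" and k: "k \<ge> 1"
    and L: "L \<subseteq> {0..<n}" "card L = k + l div 2 - 1"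
    and B: "B \<inter> L = {}" "\<And>b. b \<in> B \<Longrightarrow> L \<subseteq> nbh E b" "card B \<ge> (k + 1) * l" "finite B"
  shows "even l \<Longrightarrow> u \<in> B \<Longrightarrow> v \<in> B \<Longrightarrow> {u, v} \<notin> E"
    and "odd l \<Longrightarrow> u \<in> B \<Longrightarrow> v \<in> B \<Longrightarrow> w \<in> B \<Longrightarrow> z \<in> B \<Longrightarrow> {u, v} \<in> E \<Longrightarrow> {w, z} \<in> E \<Longrightarrow> {u, v} = {w, z}"
proof -
  note no_path = path_through_core_not_F_free[OF E l free L B]
  have ne: "x \<noteq> y" if "{x, y} \<in> E" for x y using simple_graph_edgeD[OF E that] by simp
  have offL: "x \<notin> L" if "x \<in> B" for x using B(1) that by blast
  show "{u, v} \<notin> E" if "even l" "u \<in> B" "v \<in> B"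
  proof
    assume uv: "{u, v} \<in> E"
    show False
    proof (rule no_path[of "[u, v]" "l div 2 - 1"])
      show "is_path E [u, v]" using uv ne by (auto simp: is_path_def)
      show "length [u, v] + 2 * (l div 2 - 1) = l" using that(1) l by auto
      have "set [u, v] \<inter> L = {}" using that offL by auto
      then show "card (set [u, v] \<inter> L) + (l div 2 - 1) + 1 \<le> l div 2" using l by simp
    qed (use that in auto)
  qed
  assume o: "odd l" and V: "u \<in> B" "v \<in> B" "w \<in> B" "z \<in> B" and uv: "{u, v} \<in> E" and wz: "{w, z} \<in> E"
  have adjacent: False if "{x, y} \<in> E" "{y, c} \<in> E" "x \<noteq> c" "x \<in> B" "y \<in> B" "c \<in> B" for x y c
  proof (rule no_path[of "[x, y, c]" "l div 2 - 1"])
    show "is_path E [x, y, c]" using that ne by (auto simp: is_path_def)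
    show "length [x, y, c] + 2 * (l div 2 - 1) = l" using o l by (auto elim!: oddE)
    have "set [x, y, c] \<inter> L = {}" using that offL by auto
    then show "card (set [x, y, c] \<inter> L) + (l div 2 - 1) + 1 \<le> l div 2" using l by simp
  qed (use that in auto)
  show "{u, v} = {w, z}"
  proof (rule ccontr)
    assume neq: "{u, v} \<noteq> {w, z}"
    have vu: "{v, u} \<in> E" "{z, w} \<in> E" using uv wz by (simp_all add: insert_commute)
    show False
    proof (cases "{u, v} \<inter> {w, z} = {}")
      case False
      then consider "u = w" "v \<noteq> z" | "u = z" "v \<noteq> w" | "v = w" "u \<noteq> z" | "v = z" "u \<noteq> w"
        using neq by auto
      then show False using adjacent[of v u z] adjacent[of v u w] adjacent[of u v z] adjacent[of u v w]
          uv vu wz V by cases auto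
    next
      case True
      have "L \<noteq> {}" using L(2) k l by auto
      then obtain a where a: "a \<in> L" by blast
      show False
      \<comment> \<open>The connecting vertex \<open>a\<close> costs one core vertex; with
        \<open>l div 2 - 2\<close> further ones the total is \<open>l div 2 - 1\<close>.\<close>
      proof (rule no_path[of "[u, v, a, w, z]" "l div 2 - 2"])
        have "{v, a} \<in> E" "{a, w} \<in> E"
          using B(2)[OF V(2)] B(2)[OF V(3)] a by (auto simp: nbh_def insert_commute)
        then show "is_path E [u, v, a, w, z]"
          using True uv wz ne[OF uv] ne[OF wz] a offL V by (auto simp: is_path_def)
        show "length [u, v, a, w, z] + 2 * (l div 2 - 2) = l" using o l by (auto elim!: oddE)
        have "set [u, v, a, w, z] \<inter> L = {a}" using V offL a by auto
        then show "card (set [u, v, a, w, z] \<inter> L) + (l div 2 - 2) + 1 \<le> l div 2" using l by simp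
      qed (use V in auto)
    qed
  qed
qed

text \<open>The graph contains the complete bipartite graph with parts of sizes \<open>h\<close> and
  \<open>n - h\<close>; the test vector \<open>y\<close> is the leading eigenvector of that
  subgraph.\<close>

lemma spec_rad_S_graph_ge:
  assumes "h \<le> n" "0 < h"
  shows "real h * real (n - h) \<le> (spec_rad n (S_graph n h))\<^sup>2" "0 \<le> spec_rad n (S_graph n h)"
proof -
  define a b where "a = sqrt (real (n - h))" and "b = sqrt (real h)"
  define y where "y i = (if i < h then a else b)" for i :: nat
  have ab: "a\<^sup>2 = real (n - h)" "b\<^sup>2 = real h" "a \<ge> 0" "b > 0" using assms by (auto simp: a_def b_def)
  have split: "(\<Sum>i\<in>{0..<n}. f i) = (\<Sum>i\<in>{0..<h}. f i) + (\<Sum>i\<in>{h..<n}. f i)" for f :: "nat \<Rightarrow> real"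
    using assms(1) by (simp add: sum.atLeastLessThan_concat)
  have "sqn n y = real h * a\<^sup>2 + real (n - h) * b\<^sup>2"
    unfolding sqn_def split by (simp add: y_def)
  then have s: "sqn n y = 2 * (real h * real (n - h))" using ab by simp
  have "qform n (S_graph n h) y \<ge> (\<Sum>i\<in>{0..<n}. \<Sum>j\<in>{0..<n}. if i < h \<and> h \<le> j \<or> j < h \<and> h \<le> i then a * b else 0)"
    unfolding qform_def
  proof (intro sum_mono)
    fix i j assume ij: "i \<in> {0..<n}" "j \<in> {0..<n}"
    have "{i, j} \<in> S_graph n h" if "i < h \<and> h \<le> j \<or> j < h \<and> h \<le> i"
      unfolding S_graph_eq in_full_join using that ij by auto
    then show "(if i < h \<and> h \<le> j \<or> j < h \<and> h \<le> i then a * b else 0) \<le> edge_ind (S_graph n h) i j * (y i * y j)"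
      using ab by (auto simp: edge_ind_def y_def)
  qed
  also have "(\<Sum>i\<in>{0..<n}. \<Sum>j\<in>{0..<n}. if i < h \<and> h \<le> j \<or> j < h \<and> h \<le> i then a * b else 0)
     = 2 * (real h * real (n - h)) * (a * b)"
    unfolding split by simp
  also have "qform n (S_graph n h) y \<le> spec_rad n (S_graph n h) * (2 * (real h * real (n - h)))"
    using spec_rad_Rayleigh(2)[of n "S_graph n h" y] assms unfolding s by linarith
  finally have le: "2 * (real h * real (n - h)) * (a * b) \<le>
      2 * (real h * real (n - h)) * spec_rad n (S_graph n h)"
    by (simp only: mult.commute)
  have *: "a * b \<le> spec_rad n (S_graph n h) \<or> n - h = 0"
  proof (cases "n - h = 0")
    case False
    then have "2 * (real h * real (n - h)) > 0" using assms(2) by simp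
    then show ?thesis using le mult_le_cancel_left_pos by blast
  qed simp
  \<comment> \<open>A unit vector gives nonnegativity of the radius directly, also when
    \<open>n = h\<close>, where \<open>y\<close> is useless.\<close>
  define y0 :: "nat \<Rightarrow> real" where "y0 i = (if i = 0 then 1 else 0)" for i
  have "sqn n y0 = 1" using assms by (simp add: sqn_def y0_def if_distrib[of "\<lambda>z. z\<^sup>2"] cong: if_cong)
  moreover have "qform n (S_graph n h) y0 \<ge> 0"
    unfolding qform_def by (intro sum_nonneg) (auto simp: y0_def edge_ind_def)
  ultimately show nn: "0 \<le> spec_rad n (S_graph n h)"
    using spec_rad_Rayleigh(2)[of n "S_graph n h" y0] assms by simp
  have "(a * b)\<^sup>2 = real h * real (n - h)" using ab by (simp add: power_mult_distrib)
  then show "real h * real (n - h) \<le> (spec_rad n (S_graph n h))\<^sup>2"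
    using * ab power_mono[of "a * b" "spec_rad n (S_graph n h)" 2] by auto
qed

subsection \<open>Walks of length two\<close>

locale graph_eigenvector =
  fixes n :: nat and E :: "nat set set" and x :: "nat \<Rightarrow> real" and lam :: real and u :: nat
  assumes simple: "simple_graph {0..<n} E"
    and x_nonneg: "\<And>i. x i \<ge> 0" and x_le_1: "\<And>i. i < n \<Longrightarrow> x i \<le> 1"
    and u: "u < n" and xu: "x u = 1"
    and eigen: "\<And>i. i < n \<Longrightarrow> (\<Sum>j\<in>nbh E i. x j) = lam * x i"
begin

abbreviation V :: "nat set" where "V \<equiv> {0..<n}"

lemma nbhD: "j \<in> nbh E i \<Longrightarrow> j < n"
  using nbh_subset[OF simple, of i] by auto

lemma fin_nbh [simp]: "finite (nbh E i)"
  by (rule finite_nbh[OF simple])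

lemma card_nbh_le: "card (nbh E i) \<le> n"
  using card_mono[OF _ nbh_subset[OF simple, of i]] by simp

lemma lam_x_le_degree: "i < n \<Longrightarrow> lam * x i \<le> card (nbh E i)"
  using sum_mono[of "nbh E i" x "\<lambda>_. 1"] x_le_1 nbhD eigen[of i] by simp

lemma lam_le_n: "lam \<le> n"
  using lam_x_le_degree[OF u] card_nbh_le[of u] xu by simp

lemma lam_sq_x: "i < n \<Longrightarrow> lam\<^sup>2 * x i = (\<Sum>v\<in>nbh E i. \<Sum>w\<in>nbh E v. x w)"
proof -
  assume i: "i < n"
  have "(\<Sum>v\<in>nbh E i. \<Sum>w\<in>nbh E v. x w) = (\<Sum>v\<in>nbh E i. lam * x v)"
    using eigen nbhD by (intro sum.cong) auto
  also have "\<dots> = lam * (lam * x i)"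
    using eigen[OF i] by (simp add: sum_distrib_left[symmetric])
  finally show ?thesis by (simp add: power2_eq_square mult.assoc)
qed

text \<open>Walks from \<open>i\<close> to \<open>v\<close> to \<open>w\<close> are sorted by where
  \<open>v\<close> and \<open>w\<close> lie. Those with \<open>w\<close> in \<open>L\<close> and
  \<open>v\<close> in \<open>S\<close> are regrouped by \<open>w\<close>, giving the main term;
  those inside \<open>L\<close> and those ending in \<open>S\<close>, where entries are at most
  \<open>c\<close>, are errors.\<close>

lemma walk_bound:
  assumes L: "L \<subseteq> V" and S: "S = V - L" and c: "c \<ge> 0" "\<And>w. w \<in> S \<Longrightarrow> x w \<le> c" and i: "i < n"
  shows "lam\<^sup>2 * x i \<le> (\<Sum>w\<in>L. x w * card (nbh E w \<inter> (nbh E i \<inter> S)))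
      + card (pairs E L L) + c * card (pairs E V S)"
proof -
  have finL: "finite L" using finite_subset[OF L] by simp
  have finS: "finite S" using S by simp
  have LS: "A = (A \<inter> L) \<union> (A \<inter> S)" "(A \<inter> L) \<inter> (A \<inter> S) = {}" if "A \<subseteq> V" for A
    using that L unfolding S by auto
  have split: "(\<Sum>w\<in>nbh E v. f w) = (\<Sum>w\<in>nbh E v \<inter> L. f w) + (\<Sum>w\<in>nbh E v \<inter> S. f w)" for v and f :: "nat \<Rightarrow> real"
    using LS[OF nbh_subset[OF simple, of v]] sum.union_disjoint[of "nbh E v \<inter> L" "nbh E v \<inter> S" f] by simp
  have "lam\<^sup>2 * x i = (\<Sum>v\<in>nbh E i. \<Sum>w\<in>nbh E v \<inter> L. x w) + (\<Sum>v\<in>nbh E i. \<Sum>w\<in>nbh E v \<inter> S. x w)"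
    unfolding lam_sq_x[OF i] by (subst split) (simp add: sum.distrib)
  also have "(\<Sum>v\<in>nbh E i. \<Sum>w\<in>nbh E v \<inter> L. x w) =
      (\<Sum>v\<in>nbh E i \<inter> L. \<Sum>w\<in>nbh E v \<inter> L. x w) + (\<Sum>v\<in>nbh E i \<inter> S. \<Sum>w\<in>nbh E v \<inter> L. x w)"
    by (rule split)
  also have "(\<Sum>v\<in>nbh E i \<inter> L. \<Sum>w\<in>nbh E v \<inter> L. x w) \<le> (\<Sum>v\<in>L. real (card (nbh E v \<inter> L)))"
  proof -
    have "(\<Sum>v\<in>nbh E i \<inter> L. \<Sum>w\<in>nbh E v \<inter> L. x w) \<le> (\<Sum>v\<in>L. \<Sum>w\<in>nbh E v \<inter> L. x w)"
      using finL x_nonneg by (intro sum_mono2) (auto intro: sum_nonneg)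
    also have "\<dots> \<le> (\<Sum>v\<in>L. \<Sum>w\<in>nbh E v \<inter> L. 1)"
      using x_le_1 nbhD by (intro sum_mono) auto
    finally show ?thesis by simp
  qed
  also have "(\<Sum>v\<in>L. real (card (nbh E v \<inter> L))) = card (pairs E L L)"
    using finL by (simp add: card_pairs)
  also have "(\<Sum>v\<in>nbh E i \<inter> S. \<Sum>w\<in>nbh E v \<inter> L. x w) = (\<Sum>w\<in>L. x w * card (nbh E w \<inter> (nbh E i \<inter> S)))"
  proof -
    have r: "(\<Sum>w\<in>A \<inter> B. f w) = (\<Sum>w\<in>B. if w \<in> A then f w else 0)"
      if "finite B" for A B and f :: "nat \<Rightarrow> real"
      unfolding Int_commute[of A] by (rule sum.inter_restrict[OF that])
    have "(\<Sum>v\<in>nbh E i \<inter> S. \<Sum>w\<in>nbh E v \<inter> L. x w) = (\<Sum>v\<in>nbh E i \<inter> S. \<Sum>w\<in>L. if w \<in> nbh E v then x w else 0)"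
      by (rule sum.cong[OF refl]) (rule r[OF finL])
    also have "\<dots> = (\<Sum>w\<in>L. \<Sum>v\<in>nbh E i \<inter> S. if v \<in> nbh E w then x w else 0)"
      by (subst sum.swap) (simp add: nbh_sym)
    also have "\<dots> = (\<Sum>w\<in>L. x w * card (nbh E w \<inter> (nbh E i \<inter> S)))"
      by (rule sum.cong[OF refl], subst r[symmetric]) (simp_all add: mult.commute)
    finally show ?thesis .
  qed
  also have "(\<Sum>v\<in>nbh E i. \<Sum>w\<in>nbh E v \<inter> S. x w) \<le> c * card (pairs E V S)"
  proof -
    have "(\<Sum>v\<in>nbh E i. \<Sum>w\<in>nbh E v \<inter> S. x w) \<le> (\<Sum>v\<in>V. \<Sum>w\<in>nbh E v \<inter> S. x w)"
      using x_nonneg nbh_subset[OF simple, of i] by (intro sum_mono2) (auto intro: sum_nonneg)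
    also have "\<dots> \<le> (\<Sum>v\<in>V. \<Sum>w\<in>nbh E v \<inter> S. c)"
      using c by (intro sum_mono) auto
    also have "\<dots> = c * card (pairs E V S)"
      using finS by (simp add: card_pairs sum_distrib_left mult.commute)
    finally show ?thesis .
  qed
  finally show ?thesis by simp
qed

lemma sum_common: "finite L \<Longrightarrow> finite B \<Longrightarrow> (\<Sum>w\<in>L. real (card (nbh E w \<inter> B))) = card (pairs E L B)"
  by (simp add: card_pairs)

text \<open>Without a path on \<open>l\<close> vertices, the walk count behaves as if the core had only
  \<open>l div 2 - 1 \<le> h - 1\<close> vertices, which is too few.\<close>
lemma contains_path:
  assumes l: "l \<ge> 4" and h: "l div 2 \<le> h"
    and lamsq: "real h * (real n - real h) \<le> lam\<^sup>2" and lam: "lam \<ge> 192 * real l ^ 3"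
    and n: "real n > 2 * (real h)\<^sup>2"
  shows "\<exists>xs. is_path E xs \<and> length xs = l"
proof (rule ccontr)
  assume free: "\<nexists>xs. is_path E xs \<and> length xs = l"
  \<comment> \<open>With this threshold the walks ending in \<open>S\<close> contribute at most
    \<open>c * 2 * l * n = n / 4\<close>.\<close>
  define c where "c = 1 / (8 * real l)"
  define L where "L = {w \<in> V. x w \<ge> c}"
  define S where "S = V - L"
  have cpos: "c > 0" and lpos: "real l > 0" using l by (auto simp: c_def)
  have "real l ^ 3 > 0" using lpos by simp
  then have lampos: "lam > 0" using lam by linarith
  have LV: "L \<subseteq> V" and finL: "finite L" and finS: "finite S" by (auto simp: L_def S_def)
  have cardL: "card L \<le> n" using card_mono[OF _ LV] by simp
  \<comment> \<open>Vertices of \<open>L\<close> have degree at least \<open>lam * c\<close>, while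
    a graph without the path has only linearly many edges; hence \<open>L\<close> is small.\<close>
  have "card L * (lam * c) = (\<Sum>w\<in>L. lam * c)" by simp
  also have "\<dots> \<le> (\<Sum>w\<in>L. real (card (nbh E w \<inter> V)))"
  proof (intro sum_mono)
    fix w assume w: "w \<in> L"
    have "lam * c \<le> lam * x w" using w lampos by (simp add: L_def)
    also have "\<dots> \<le> card (nbh E w)" using lam_x_le_degree w LV by auto
    finally show "lam * c \<le> card (nbh E w \<inter> V)"
      using nbh_subset[OF simple, of w] by (simp add: Int_absorb2)
  qed
  also have "\<dots> = card (pairs E L V)" using finL by (simp add: card_pairs)
  also have "\<dots> \<le> real (l * card L + l * card V)"
    using pairs_bound_path_free(1)[OF free finL, of V] by (simp only: of_nat_le_iff) simp
  also have "\<dots> \<le> 2 * l * n" using cardL by (simp add: mult_left_mono)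
  finally have "card L * lam \<le> 16 * (real l)\<^sup>2 * n"
    using lpos by (simp add: c_def field_simps power2_eq_square)
  then have "card L * (192 * real l ^ 3) \<le> 16 * (real l)\<^sup>2 * n"
    using mult_left_mono[OF lam, of "card L"] by linarith
  then have "(real l)\<^sup>2 * (12 * real l * card L) \<le> (real l)\<^sup>2 * n"
    by (simp add: power2_eq_square power3_eq_cube mult_ac)
  then have L12: "12 * real l * card L \<le> n"
    using lpos by (simp add: mult_le_cancel_left)
  have "lam\<^sup>2 * x u \<le> (\<Sum>w\<in>L. x w * card (nbh E w \<inter> (nbh E u \<inter> S)))
      + card (pairs E L L) + c * card (pairs E V S)"
    by (rule walk_bound[OF LV S_def _ _ u]) (use cpos in \<open>auto simp: S_def L_def\<close>)
  moreover have "(\<Sum>w\<in>L. x w * card (nbh E w \<inter> (nbh E u \<inter> S))) \<le> (\<Sum>w\<in>L. real (card (nbh E w \<inter> (nbh E u \<inter> S))))"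
    using x_le_1 x_nonneg LV by (intro sum_mono mult_left_le_one_le) auto
  moreover have "(\<Sum>w\<in>L. real (card (nbh E w \<inter> (nbh E u \<inter> S)))) \<le> real l * card L + (real h - 1) * n"
  proof -
    have "card (pairs E L (nbh E u \<inter> S)) \<le> l * card L + (l div 2 - 1) * card (nbh E u \<inter> S)"
      using l by (intro pairs_bound_path_free(2)[OF free finL]) (auto simp: S_def)
    also have "\<dots> \<le> l * card L + (h - 1) * n"
      using h card_mono[of "nbh E u" "nbh E u \<inter> S"] card_nbh_le[of u]
      by (intro add_left_mono mult_le_mono) auto
    finally have "real (card (pairs E L (nbh E u \<inter> S))) \<le> real (l * card L + (h - 1) * n)"
      by (simp only: of_nat_le_iff)
    also have "\<dots> = real l * card L + (real h - 1) * n" using h l by (simp add: of_nat_diff)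
    finally show ?thesis using finL by (simp add: sum_common)
  qed
  moreover have "real (card (pairs E L L)) \<le> 2 * real l * card L"
    using pairs_bound_path_free(1)[OF free finL finL]
    by (metis mult_2 distrib_right of_nat_le_iff of_nat_mult of_nat_numeral)
  moreover have "c * card (pairs E V S) \<le> n / 4"
  proof -
    have "card (pairs E V S) \<le> l * card V + l * card S"
      by (rule pairs_bound_path_free(1)[OF free _ finS]) simp
    also have "\<dots> \<le> 2 * l * n" using card_mono[of V S] by (simp add: S_def)
    finally have "c * card (pairs E V S) \<le> c * real (2 * l * n)"
      using cpos by (intro mult_left_mono) (simp_all only: of_nat_le_iff less_imp_le)
    then show ?thesis using lpos by (simp add: c_def)
  qed
  \<comment> \<open>By \<open>L12\<close> the first term is at most \<open>n / 4\<close>, so the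
    right side is at most \<open>(h - 1/2) * n\<close>, less than \<open>h * (n - h)\<close> because
    \<open>n > 2 * h^2\<close>.\<close>
  ultimately have "lam\<^sup>2 \<le> 3 * real l * card L + (real h - 1) * n + n / 4"
    using xu by simp
  then show False using lamsq L12 n by (simp add: algebra_simps power2_eq_square)
qed

end

subsection \<open>The core of a graph of large spectral radius\<close>

text \<open>\<open>N\<close> is the order of the forest. \<open>lam_sq\<close> is the bipartite
  lower bound and \<open>lam_sq'\<close> a consequence of it for large \<open>n\<close> without the
  subtracted square.\<close>

locale spectral_core = graph_eigenvector +
  fixes k l h N :: nat
  assumes k: "k \<ge> 1" and l: "l \<ge> 4"
    and h_def: "h = k + l div 2 - 1" and N_def: "N = (k + 1) * l"
    and free: "F_free (F_vert k l) (F_edges k l) {0..<n} E"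
    and lam_sq: "real h * (real n - real h) \<le> lam\<^sup>2"
    and lam_sq': "(real h + 1) * real n \<le> 2 * lam\<^sup>2"
    and lam_big: "lam \<ge> 162 * (real h + 1)\<^sup>2 * real N ^ 4"
    and has_path: "\<exists>xs. is_path E xs \<and> length xs = l"
begin

section \<open>Hubs and the error of the walk count\<close>

text \<open>The vertices whose degree allows them to serve as star centres in any partial
  embedding.\<close>

definition hubs :: "nat set" where "hubs = {v \<in> V. card (nbh E v) \<ge> N}"

definition low :: "nat set" where "low = V - hubs"

text \<open>The total error of the walk count at hubs: \<open>N^2\<close> from walks inside the hubs
  and \<open>2 * N^2 * n / lam\<close> from walks ending at low vertices, merged by
  \<open>lam \<le> n\<close>.\<close>

definition rho :: real where "rho = 3 * (real N)\<^sup>2 * n / lam"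

text \<open>The threshold makes hubs outside the core contribute about
  \<open>h * n / (4 * h) = n / 4\<close> to the walk count, less than one core vertex can.\<close>

definition core :: "nat set" where "core = {w \<in> V. x w \<ge> 1 / (4 * real h)}"

definition common :: "nat \<Rightarrow> nat \<Rightarrow> real" where
  "common i w = card (nbh E w \<inter> (nbh E i \<inter> low))"

lemma h_ge_2: "h \<ge> 2" and Suc_h: "h + 1 = k + l div 2" and N_ge_8: "N \<ge> 8" and h_N: "2 * (h + 1) \<le> N"
proof -
  have "l div 2 \<ge> 2" using l by linarith
  then show "h \<ge> 2" "h + 1 = k + l div 2" using k h_def by auto
  have "2 * 4 \<le> N" unfolding N_def using k l by (intro mult_le_mono) auto
  then show "N \<ge> 8" by simp
  have "k * 4 \<le> k * l" using l by simp
  moreover have "2 * (l div 2) \<le> l" by simp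
  moreover have "N = k * l + l" "2 * k \<le> k * 4" by (simp_all add: N_def)
  moreover have "2 * (h + 1) = 2 * k + 2 * (l div 2)"
    using \<open>h + 1 = k + l div 2\<close> by (simp only: distrib_left)
  ultimately show "2 * (h + 1) \<le> N" by (metis add_le_mono le_trans)
qed

lemma hubs_sub: "hubs \<subseteq> V" and fin_hubs [simp]: "finite hubs"
  and low_sub: "low \<subseteq> V" and fin_low [simp]: "finite low"
  and core_sub: "core \<subseteq> V" and fin_core [simp]: "finite core"
  by (auto simp: hubs_def low_def core_def)

lemma not_F: "\<not> has_subgraph {0..<n} E (F_vert k l) (F_edges k l)"
  using free by (simp add: F_free_def)

text \<open>An existing path together with \<open>k\<close> hubs off it would give the forest, so
  there are fewer than \<open>k + l\<close> hubs.\<close>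

lemma card_hubs: "card hubs \<le> N"
proof -
  obtain xs where xs: "is_path E xs" "length xs = l" using has_path by blast
  have "card (hubs - set xs) < k"
  proof (rule ccontr)
    assume "\<not> card (hubs - set xs) < k"
    then have "has_subgraph {0..<n} E (F_vert k l) (F_edges k l)"
    proof (intro has_F_if_path_and_centres[OF simple xs, of "hubs - set xs"])
      show "(k + 1) * l \<le> card (nbh E c)" if "c \<in> hubs - set xs" for c
        using that unfolding hubs_def N_def[symmetric] by simp
    qed (use l hubs_sub in auto)
    then show False using not_F by simp
  qed
  moreover have "card hubs \<le> card (hubs - set xs) + card (set xs)"
    by (metis card_Un_le Un_Diff_cancel2 card_mono fin_hubs finite_Un List.finite_set Un_upper1 finite_Diff order_trans)
  moreover have "card (set xs) \<le> l" using card_length[of xs] xs(2) by simp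
  moreover have "k + l \<le> N" using N_def k l by simp
  ultimately show ?thesis by linarith
qed

lemma lam_pos: "lam > 0" and n_ge_lam: "real n \<ge> lam" and lam_N4: "lam \<ge> 1458 * real N ^ 4"
proof -
  have "(real h + 1)\<^sup>2 \<ge> 3\<^sup>2" using h_ge_2 by (intro power_mono) auto
  then have "162 * (real h + 1)\<^sup>2 * real N ^ 4 \<ge> 162 * 9 * real N ^ 4" by (intro mult_right_mono) auto
  then show "lam \<ge> 1458 * real N ^ 4" using lam_big by linarith
  moreover have "real N ^ 4 > 0" using N_ge_8 by simp
  ultimately show "lam > 0" by linarith
  show "real n \<ge> lam" using lam_le_n .
qed

lemma n_pos: "real n > 0" using lam_pos n_ge_lam by linarith

lemma N_sq_rho: "3 * (real N)\<^sup>2 \<le> rho"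
proof -
  have "3 * (real N)\<^sup>2 * 1 \<le> 3 * (real N)\<^sup>2 * (n / lam)"
    using lam_pos n_ge_lam by (intro mult_left_mono) auto
  then show ?thesis by (simp add: rho_def)
qed

lemma rho_pos: "rho > 0"
  using lam_pos n_pos N_ge_8 by (simp add: rho_def)

text \<open>This is where \<open>lam_big\<close> pays: the factor 162 is 54 times the 3 in
  \<open>rho\<close>.\<close>

lemma rho_small: "54 * (real h + 1)\<^sup>2 * (real N)\<^sup>2 * rho \<le> n"
proof -
  have "54 * (real h + 1)\<^sup>2 * (real N)\<^sup>2 * rho = (162 * (real h + 1)\<^sup>2 * real N ^ 4) * n / lam"
    by (simp add: rho_def power4_eq_xxxx power2_eq_square mult_ac)
  also have "\<dots> \<le> lam * n / lam"
    using lam_big lam_pos by (intro divide_right_mono mult_right_mono) auto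
  finally show ?thesis using lam_pos by simp
qed

lemma rho_small_h: "3456 * (real h + 1)\<^sup>2 * rho \<le> n"
proof -
  have "(real N)\<^sup>2 \<ge> 8\<^sup>2" using N_ge_8 by (intro power_mono) auto
  then have "54 * (real h + 1)\<^sup>2 * 64 * rho \<le> 54 * (real h + 1)\<^sup>2 * (real N)\<^sup>2 * rho"
    using rho_pos by (intro mult_right_mono mult_left_mono) auto
  then show ?thesis using rho_small by linarith
qed

lemma rho_small_abs: "31104 * rho \<le> n"
proof -
  have "(real h + 1)\<^sup>2 \<ge> 3\<^sup>2" using h_ge_2 by (intro power_mono) auto
  then have "3456 * 9 * rho \<le> 3456 * (real h + 1)\<^sup>2 * rho"
    using rho_pos by (intro mult_right_mono mult_left_mono) auto
  then show ?thesis using rho_small_h by linarith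
qed

lemma h_sq: "(real h)\<^sup>2 \<le> (real N)\<^sup>2 / 4" "real h \<le> (real N)\<^sup>2" "real N \<le> (real N)\<^sup>2"
proof -
  have "real (2 * (h + 1)) \<le> real N" using h_N by (simp only: of_nat_le_iff)
  then have *: "2 * real h \<le> real N" by simp
  then have "(2 * real h)\<^sup>2 \<le> (real N)\<^sup>2" by (intro power_mono) auto
  then show "(real h)\<^sup>2 \<le> (real N)\<^sup>2 / 4" by (simp add: power_mult_distrib)
  show "real N \<le> (real N)\<^sup>2" using N_ge_8 by (simp add: power2_eq_square)
  then show "real h \<le> (real N)\<^sup>2" using * by simp
qed

lemma x_low: "w \<in> low \<Longrightarrow> x w \<le> N / lam"
proof -
  assume "w \<in> low"
  then have "w < n" "real (card (nbh E w)) \<le> N" by (auto simp: low_def hubs_def)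
  then have "lam * x w \<le> N" using lam_x_le_degree[of w] by linarith
  then show ?thesis using lam_pos by (simp add: field_simps)
qed

lemma core_hubs: "core \<subseteq> hubs"
proof
  fix w assume w: "w \<in> core"
  show "w \<in> hubs"
  proof (rule ccontr)
    assume "w \<notin> hubs"
    then have "w \<in> low" using w core_sub by (auto simp: low_def)
    then have "1 / (4 * real h) \<le> N / lam" using x_low[of w] w by (simp add: core_def)
    then have "lam \<le> 4 * real h * N" using lam_pos h_ge_2 by (simp add: field_simps)
    also have "\<dots> \<le> 4 * real N * N" using h_N by (intro mult_right_mono) auto
    also have "\<dots> \<le> 4 * real N ^ 4"
      using power_increasing[of 2 4 "real N"] N_ge_8 by (simp add: power2_eq_square)
    finally have "1458 * real N ^ 4 \<le> 4 * real N ^ 4" using lam_N4 by linarith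
    moreover have "real N ^ 4 > 0" using N_ge_8 by simp
    ultimately show False by linarith
  qed
qed

lemma common_nonneg: "common i w \<ge> 0" and common_le: "common i w \<le> n"
proof -
  have "card (nbh E w \<inter> (nbh E i \<inter> low)) \<le> card (nbh E w)" by (rule card_mono) auto
  then show "common i w \<ge> 0" "common i w \<le> n" using card_nbh_le[of w] by (simp_all add: common_def)
qed

text \<open>Low vertices have degree below \<open>N\<close>, hence entries at most
  \<open>N / lam\<close>; \<open>walk_bound\<close> is applied with this value as
  \<open>c\<close>.\<close>

lemma walk_estimate: "i < n \<Longrightarrow> lam\<^sup>2 * x i \<le> (\<Sum>w\<in>hubs. x w * common i w) + rho"
proof -
  assume i: "i < n"
  have "lam\<^sup>2 * x i \<le> (\<Sum>w\<in>hubs. x w * card (nbh E w \<inter> (nbh E i \<inter> low)))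
      + card (pairs E hubs hubs) + (N / lam) * card (pairs E V low)"
    using x_low lam_pos i by (intro walk_bound[OF hubs_sub low_def]) auto
  moreover have "real (card (pairs E hubs hubs)) \<le> (real N)\<^sup>2"
  proof -
    have "card (pairs E hubs hubs) \<le> card (hubs \<times> hubs)"
      by (rule card_mono) (auto simp: pairs_def)
    also have "\<dots> \<le> N * N" using card_hubs by (simp add: card_cartesian_product mult_le_mono)
    finally show ?thesis unfolding power2_eq_square by (metis of_nat_le_iff of_nat_mult)
  qed
  moreover have "(N / lam) * card (pairs E V low) \<le> 2 * (real N)\<^sup>2 * n / lam"
  proof -
    have "card (pairs E V low) = (\<Sum>v\<in>low. card (nbh E v \<inter> V))"
      unfolding pairs_swap[of E V low] by (simp add: card_pairs)
    also have "\<dots> \<le> (\<Sum>v\<in>low. N)"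
    proof (intro sum_mono)
      fix v assume "v \<in> low"
      then have "card (nbh E v) \<le> N" by (auto simp: low_def hubs_def)
      moreover have "card (nbh E v \<inter> V) \<le> card (nbh E v)" by (rule card_mono) auto
      ultimately show "card (nbh E v \<inter> V) \<le> N" by simp
    qed
    also have "\<dots> \<le> 2 * n * N" using card_mono[OF _ low_sub] by simp
    finally have "real (card (pairs E V low)) \<le> real (2 * n * N)" by (simp only: of_nat_le_iff)
    then have "(N / lam) * card (pairs E V low) \<le> (N / lam) * real (2 * n * N)"
      using lam_pos by (intro mult_left_mono) auto
    then show ?thesis by (simp add: power2_eq_square mult_ac)
  qed
  moreover have "(real N)\<^sup>2 + 2 * (real N)\<^sup>2 * n / lam \<le> rho"
  proof -
    define z where "z = (real N)\<^sup>2 * n / lam"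
    have "rho = 3 * z" "2 * (real N)\<^sup>2 * n / lam = 2 * z" by (simp_all add: rho_def z_def)
    then show ?thesis using N_sq_rho by linarith
  qed
  ultimately show ?thesis unfolding common_def by linarith
qed

lemma sum_common_le: "(\<Sum>w\<in>hubs. common i w) \<le> h * real (card (nbh E i)) + (real N)\<^sup>2"
proof -
  have "card (pairs E hubs (nbh E i \<inter> low)) \<le> (k + 1) * l * card hubs + (k + l div 2 - 1) * card (nbh E i \<inter> low)"
    using l k hubs_sub low_sub by (intro pairs_bound_F_free[OF simple _ _ free]) (auto simp: low_def)
  also have "\<dots> \<le> N * N + h * card (nbh E i)"
    unfolding h_def[symmetric] N_def[symmetric] using card_hubs
    by (intro add_mono mult_le_mono card_mono) auto
  finally have "real (card (pairs E hubs (nbh E i \<inter> low))) \<le> real (N * N + h * card (nbh E i))"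
    by (simp only: of_nat_le_iff)
  then show ?thesis by (simp add: common_def sum_common power2_eq_square)
qed

text \<open>The hubs supply at most about \<open>h * card (nbh E i)\<close> walks of length two, so
  a large entry forces a degree close to \<open>n * x i\<close>.\<close>

lemma degree_estimate:
  assumes i: "i < n"
  shows "(real n - h) * x i - 2 * rho / h \<le> card (nbh E i)"
proof -
  have "(\<Sum>w\<in>hubs. x w * common i w) \<le> (\<Sum>w\<in>hubs. common i w)"
    using x_nonneg x_le_1 hubs_sub common_nonneg by (intro sum_mono mult_left_le_one_le) auto
  then have "lam\<^sup>2 * x i \<le> h * real (card (nbh E i)) + (real N)\<^sup>2 + rho"
    using walk_estimate[OF i] sum_common_le[of i] by linarith
  moreover have "real h * (real n - real h) * x i \<le> lam\<^sup>2 * x i"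
    using lam_sq x_nonneg by (intro mult_right_mono) auto
  ultimately have "real h * (real n - real h) * x i - 2 * rho \<le> h * real (card (nbh E i))"
    using N_sq_rho rho_pos by linarith
  moreover have "h * ((real n - h) * x i - 2 * rho / h) = real h * (real n - real h) * x i - 2 * rho"
    using h_ge_2 by (simp add: field_simps)
  ultimately have "h * ((real n - h) * x i - 2 * rho / h) \<le> h * real (card (nbh E i))" by linarith
  then show ?thesis using h_ge_2 by (simp only: mult_le_cancel_left_pos)
qed

section \<open>Size, entries and degrees of the core\<close>

text \<open>Walk count at the maximal vertex \<open>u\<close>: core entries are bounded by 1, the
  other hubs by the threshold, and \<open>sum_common_le\<close> limits what the latter can still
  receive.\<close>

lemma core_weight:
  "real h * (real n - h) \<le> (\<Sum>w\<in>core. common u w)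
     + (h * real n + (real N)\<^sup>2 - (\<Sum>w\<in>core. common u w)) / (4 * h) + rho"
proof -
  have split: "(\<Sum>w\<in>hubs. f w) = (\<Sum>w\<in>core. f w) + (\<Sum>w\<in>hubs - core. f w)" for f :: "nat \<Rightarrow> real"
    using sum.subset_diff[OF core_hubs] by (simp add: add.commute)
  have "(\<Sum>w\<in>core. x w * common u w) \<le> (\<Sum>w\<in>core. common u w)"
    using x_nonneg x_le_1 core_sub common_nonneg by (intro sum_mono mult_left_le_one_le) auto
  moreover have "(\<Sum>w\<in>hubs - core. x w * common u w) \<le> (\<Sum>w\<in>hubs - core. 1 / (4 * h) * common u w)"
    using hubs_sub common_nonneg by (intro sum_mono mult_right_mono) (auto simp: core_def)
  moreover have "(\<Sum>w\<in>hubs - core. 1 / (4 * h) * common u w) = (\<Sum>w\<in>hubs - core. common u w) / (4 * h)"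
    by (simp add: sum_divide_distrib)
  moreover have "(\<Sum>w\<in>hubs - core. common u w) / (4 * h) \<le> (h * real n + (real N)\<^sup>2 - (\<Sum>w\<in>core. common u w)) / (4 * h)"
  proof (rule divide_right_mono)
    have "h * real (card (nbh E u)) \<le> h * real n" using card_nbh_le[of u] by (intro mult_left_mono) auto
    then show "(\<Sum>w\<in>hubs - core. common u w) \<le> h * real n + (real N)\<^sup>2 - (\<Sum>w\<in>core. common u w)"
      using sum_common_le[of u] split[of "common u"] by linarith
  qed simp
  ultimately show ?thesis
    using walk_estimate[OF u] lam_sq split[of "\<lambda>w. x w * common u w"] xu by simp
qed

text \<open>With \<open>h - 1\<close> core vertices the count would reach only about
  \<open>(h - 1) * n + n / 4\<close>, short of \<open>h * n\<close>.\<close>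

lemma card_core_ge: "card core \<ge> h"
proof (rule ccontr)
  assume "\<not> card core \<ge> h"
  then have "real (card core) \<le> real h - 1" by linarith
  moreover define C where "C = (\<Sum>w\<in>core. common u w)"
  moreover have "C \<le> card core * real n"
    unfolding C_def using sum_mono[of core "common u" "\<lambda>_. real n"] common_le by simp
  ultimately have C: "C \<le> (real h - 1) * n"
    using mult_right_mono[of "real (card core)" "real h - 1" "real n"] by linarith
  have C0: "C \<ge> 0" unfolding C_def using common_nonneg by (intro sum_nonneg) auto
  have "(h * real n + (real N)\<^sup>2 - C) / (4 * h) \<le> (h * real n + (real N)\<^sup>2) / (4 * h)"
    using C0 by (intro divide_right_mono) auto
  also have "\<dots> = n / 4 + (real N)\<^sup>2 / (4 * h)" using h_ge_2 by (simp add: field_simps)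
  also have "(real N)\<^sup>2 / (4 * h) \<le> (real N)\<^sup>2"
    using h_ge_2 by (simp add: divide_le_eq mult_le_cancel_left1)
  finally have "real h * (real n - h) \<le> (real h - 1) * n + n / 4 + (real N)\<^sup>2 + rho"
    using core_weight C unfolding C_def by linarith
  then have "n * 3 / 4 \<le> (real h)\<^sup>2 + (real N)\<^sup>2 + rho"
    by (simp add: algebra_simps power2_eq_square)
  then show False using N_sq_rho h_sq rho_small_abs rho_pos n_pos by linarith
qed

text \<open>The sum over the hubs of \<open>(1 - x w) * common u w\<close> is at most
  \<open>2 * rho\<close>, since upper and lower bounds for the walk count nearly agree. A core
  vertex shares at least \<open>n / (8 * h)\<close> neighbours with \<open>u\<close>, so its own
  deficit is small.\<close>

lemma core_entry:
  assumes w: "w \<in> core"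
  shows "1 - x w \<le> 16 * h * rho / n"
proof -
  have wn: "w < n" using w core_sub by auto
  have hpos: "real h \<ge> 2" using h_ge_2 by simp
  have xw: "x w \<ge> 1 / (4 * h)" using w by (simp add: core_def)
  have nh: "real n - h \<ge> 0" using rho_small_abs N_sq_rho h_sq rho_pos by linarith
  have "(real n - h) * (1 / (4 * h)) \<le> (real n - h) * x w" using nh xw by (intro mult_left_mono) auto
  then have dw: "(real n - h) / (4 * h) - 2 * rho / h \<le> card (nbh E w)"
    using degree_estimate[OF wn] by simp
  have du: "real n - h - 2 * rho / h \<le> card (nbh E u)" using degree_estimate[OF u] xu by simp
  have c: "common u w \<ge> real (card (nbh E w)) + card (nbh E u) - n - N"
  proof -
    have "card (nbh E w \<union> nbh E u) \<le> n"
      using nbh_subset[OF simple] card_mono[of V "nbh E w \<union> nbh E u"] by simp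
    then have "card (nbh E w) + card (nbh E u) \<le> n + card (nbh E w \<inter> nbh E u)"
      using card_Un_Int[of "nbh E w" "nbh E u"] by simp
    moreover have "card (nbh E w \<inter> nbh E u) \<le> card (nbh E w \<inter> (nbh E u \<inter> low)) + card hubs"
    proof -
      have "nbh E w \<inter> nbh E u \<subseteq> (nbh E w \<inter> (nbh E u \<inter> low)) \<union> hubs"
        using nbhD by (auto simp: low_def)
      then have "card (nbh E w \<inter> nbh E u) \<le> card ((nbh E w \<inter> (nbh E u \<inter> low)) \<union> hubs)"
        by (intro card_mono) auto
      then show ?thesis using card_Un_le order_trans by blast
    qed
    ultimately have "card (nbh E w) + card (nbh E u) \<le> n + card (nbh E w \<inter> (nbh E u \<inter> low)) + N"
      using card_hubs by linarith
    then show ?thesis unfolding common_def by linarith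
  qed
  \<comment> \<open>The degree of \<open>w\<close> is about \<open>n / (4 * h)\<close> or more and
    that of \<open>u\<close> about \<open>n\<close>; half of the overlap absorbs the errors.\<close>
  have c8: "common u w \<ge> n / (8 * h)"
  proof -
    have "n / (8 * h) + n / (8 * h) = (real n - h) / (4 * h) + 1 / 4" using hpos by (simp add: field_simps)
    moreover have "n / (8 * h) \<ge> 1 / 4 + h + 4 * rho / h + N"
    proof -
      have "(1 / 4 + h + 4 * rho / h + N) * (8 * h) = 2 * h + 8 * (real h)\<^sup>2 + 32 * rho + 8 * (N * h)"
        using hpos by (simp add: field_simps power2_eq_square)
      also have "\<dots> \<le> n"
      proof -
        have "real (N * h) \<le> (real N)\<^sup>2"
          using h_N unfolding power2_eq_square by (simp add: mult_left_mono)
        moreover have "real (2 * h) = 2 * real h" "real (8 * (N * h)) = 8 * real (N * h)" by simp_all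
        ultimately show ?thesis using N_sq_rho h_sq(1,2) rho_small_abs rho_pos by linarith
      qed
      finally show ?thesis using hpos by (simp add: pos_le_divide_eq)
    qed
    ultimately show ?thesis using c du dw by linarith
  qed
  have "(1 - x w) * common u w \<le> (\<Sum>w\<in>hubs. (1 - x w) * common u w)"
    using w core_hubs hubs_sub x_le_1 common_nonneg by (intro member_le_sum) auto
  also have "\<dots> = (\<Sum>w\<in>hubs. common u w) - (\<Sum>w\<in>hubs. x w * common u w)"
    by (simp add: sum_subtractf left_diff_distrib)
  also have "\<dots> \<le> 2 * rho"
  proof -
    have "h * real (card (nbh E u)) \<le> h * real n" using card_nbh_le[of u] by (intro mult_left_mono) auto
    moreover have "lam\<^sup>2 \<le> (\<Sum>w\<in>hubs. x w * common u w) + rho" using walk_estimate[OF u] xu by simp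
    moreover have "real h * (real n - h) = h * real n - (real h)\<^sup>2" by (simp add: algebra_simps power2_eq_square)
    ultimately show ?thesis using sum_common_le[of u] lam_sq N_sq_rho h_sq by linarith
  qed
  finally have "(1 - x w) * common u w \<le> 2 * rho" .
  moreover have "(1 - x w) * (n / (8 * h)) \<le> (1 - x w) * common u w"
    using c8 x_le_1[OF wn] by (intro mult_left_mono) auto
  ultimately have "(1 - x w) * (n / (8 * h)) \<le> 2 * rho" by linarith
  then show ?thesis using hpos n_pos by (simp add: field_simps)
qed

text \<open>Bootstrapping: the entry, now known to be near 1, is fed back into
  \<open>degree_estimate\<close>.\<close>

lemma core_degree:
  assumes w: "w \<in> core"
  shows "real n - card (nbh E w) \<le> 18 * h * rho"
proof -
  have wn: "w < n" using w core_sub by auto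
  have hpos: "real h \<ge> 2" using h_ge_2 by simp
  have nh: "0 \<le> real n - h" using rho_small_abs N_sq_rho h_sq rho_pos by linarith
  have "(real n - h) * (1 - x w) \<le> n * (16 * h * rho / n)"
    using core_entry[OF w] nh x_le_1[OF wn] by (intro mult_mono) auto
  then have "(real n - h) - 16 * h * rho \<le> (real n - h) * x w"
    using n_pos by (simp add: right_diff_distrib)
  moreover have "2 * rho / h \<le> rho" using hpos rho_pos by (simp add: field_simps)
  moreover have "rho * 2 \<le> rho * h" using hpos rho_pos by (intro mult_left_mono) auto
  then have "2 * rho \<le> h * rho" by (simp add: mult.commute)
  moreover have "real h \<le> rho" using N_sq_rho h_sq by linarith
  ultimately show ?thesis using degree_estimate[OF wn] by linarith
qed

lemma core_entry_half: "w \<in> core \<Longrightarrow> x w \<ge> 1 / 2"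
proof -
  assume w: "w \<in> core"
  have "real h \<le> (real h + 1)\<^sup>2" by (simp add: power2_eq_square algebra_simps)
  then have "32 * h * rho \<le> 3456 * (real h + 1)\<^sup>2 * rho"
    using rho_pos by (intro mult_right_mono) auto
  then have "32 * h * rho \<le> n" using rho_small_h by linarith
  then have "16 * h * rho / n \<le> 1 / 2" using n_pos by (simp add: field_simps)
  then show ?thesis using core_entry[OF w] by linarith
qed

text \<open>By \<open>core_degree\<close>, \<open>h + 1\<close> core vertices would have at least
  \<open>n / 2\<close> common neighbours, a dense bipartite piece containing the forest.\<close>

lemma card_core: "card core = h"
proof (rule antisym[OF _ card_core_ge], rule ccontr)
  assume "\<not> card core \<le> h"
  then obtain A where A: "A \<subseteq> core" "card A = h + 1"
    using obtain_subset_with_card_n[of "h + 1" core] by (metis not_less_eq_eq Suc_eq_plus1)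
  have finA: "finite A" using A(1) finite_subset fin_core by blast
  have Ane: "A \<noteq> {}" using A(2) by auto
  define B where "B = (\<Inter>a\<in>A. nbh E a)"
  have sub: "V - B \<subseteq> (\<Union>a\<in>A. V - nbh E a)" by (auto simp: B_def)
  have BV: "B \<subseteq> V" using Ane nbh_subset[OF simple] by (auto simp: B_def)
  have "card (V - B) \<le> (\<Sum>a\<in>A. card (V - nbh E a))"
    using card_mono[OF _ sub] card_UN_le[OF finA, of "\<lambda>a. V - nbh E a"] finA by simp
  then have "real (card (V - B)) \<le> (\<Sum>a\<in>A. real (card (V - nbh E a)))"
    by (simp only: of_nat_le_iff flip: of_nat_sum)
  also have "\<dots> \<le> (\<Sum>a\<in>A. 18 * h * rho)"
  proof (intro sum_mono)
    fix a assume "a \<in> A"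
    then have "real n - card (nbh E a) \<le> 18 * h * rho" using core_degree A by auto
    then show "real (card (V - nbh E a)) \<le> 18 * h * rho"
      using card_Diff_subset[OF fin_nbh nbh_subset[OF simple, of a]] card_nbh_le[of a] by (simp add: of_nat_diff)
  qed
  also have "\<dots> = (real h + 1) * (18 * h * rho)" using A(2) by simp
  also have "\<dots> \<le> 18 * (real h + 1)\<^sup>2 * rho"
  proof -
    have "(real h + 1) * real h \<le> (real h + 1)\<^sup>2" by (simp add: power2_eq_square)
    then have "(real h + 1) * real h * rho \<le> (real h + 1)\<^sup>2 * rho" using rho_pos by (intro mult_right_mono) auto
    then show ?thesis by simp
  qed
  also have "\<dots> \<le> n / 2" using rho_small_h rho_pos by simp
  finally have "real (card (V - B)) \<le> n / 2" .
  then have "real (card B) \<ge> n / 2"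
    using card_Diff_subset[OF finite_subset[OF BV] BV] card_mono[OF _ BV] by (simp add: of_nat_diff)
  moreover have "real N \<le> n / 2" using h_sq(3) N_sq_rho rho_small_abs rho_pos by linarith
  ultimately have cB: "card B \<ge> N" by linarith
  then have "B \<noteq> {}" using N_ge_8 by auto
  then obtain b0 where b0: "b0 \<in> B" by blast
  have "has_subgraph {0..<n} E (F_vert k l) (F_edges k l)"
  proof (rule has_F_if_dense_bipartite[OF simple _ k _ b0])
    show "A \<inter> B = {}" using nbh_irrefl[OF simple] by (auto simp: B_def)
    show "A \<subseteq> V" using A core_sub by auto
    show "(k + 1) * l \<le> card (nbh E a \<inter> B)" if "a \<in> A" for a
    proof -
      have "nbh E a \<inter> B = B" using that by (auto simp: B_def)
      then show ?thesis using cB N_def by simp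
    qed
    show "k + l div 2 \<le> card (nbh E b \<inter> A)" if "b \<in> B" for b
    proof -
      have "nbh E b \<inter> A = A" using that nbh_sym by (auto simp: B_def)
      then show ?thesis using A Suc_h by simp
    qed
  qed (use l in auto)
  then show False using not_F by simp
qed

section \<open>Exceptional and regular vertices\<close>

definition exc :: "nat set" where "exc = {v \<in> V - core. \<not> core \<subseteq> nbh E v}"

definition reg :: "nat set" where "reg = V - core - exc"

lemma exc_sub: "exc \<subseteq> V" and fin_exc [simp]: "finite exc" and fin_reg [simp]: "finite reg"
  and reg_core: "reg \<inter> core = {}" and reg_nbh: "b \<in> reg \<Longrightarrow> core \<subseteq> nbh E b"
  by (auto simp: exc_def reg_def)

text \<open>An exceptional vertex is missing from the common neighbourhood of \<open>u\<close> and
  some core vertex. These absences total \<open>D = h * n - C\<close>, which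
  \<open>core_weight\<close> keeps small.\<close>

lemma card_exc: "card exc \<le> 2 * rho"
proof -
  define C where "C = (\<Sum>w\<in>core. common u w)"
  have hpos: "real h \<ge> 2" using h_ge_2 by simp
  define D where "D = h * real n - C"
  have cw: "h * real n - (real h)\<^sup>2 \<le> C + (D + (real N)\<^sup>2) / (4 * h) + rho"
    using core_weight unfolding C_def[symmetric] D_def by (simp add: algebra_simps power2_eq_square)
  have CD: "D \<ge> 0"
  proof -
    have "C \<le> card core * real n"
      unfolding C_def using sum_mono[of core "common u" "\<lambda>_. real n"] common_le by simp
    then show ?thesis by (simp add: D_def card_core)
  qed
  \<comment> \<open>As \<open>4 * h \<ge> 8\<close>, the term containing \<open>D\<close> on the
    right can be absorbed on the left.\<close>
  have "(D + (real N)\<^sup>2) / (4 * h) \<le> (D + (real N)\<^sup>2) / 8"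
    using hpos CD by (intro divide_left_mono) auto
  then have "D \<le> (real h)\<^sup>2 + (D + (real N)\<^sup>2) / 8 + rho" using cw unfolding D_def by linarith
  then have "8 * D \<le> 8 * (real h)\<^sup>2 + D + (real N)\<^sup>2 + 8 * rho"
    by (simp add: add_divide_distrib)
  then have D2: "D \<le> 2 * rho" using N_sq_rho h_sq(1) rho_pos by linarith
  have "exc \<subseteq> (\<Union>w\<in>core. V - (nbh E w \<inter> (nbh E u \<inter> low)))"
    using nbh_sym by (auto simp: exc_def)
  then have "card exc \<le> card (\<Union>w\<in>core. V - (nbh E w \<inter> (nbh E u \<inter> low)))"
    by (intro card_mono) auto
  also have "\<dots> \<le> (\<Sum>w\<in>core. card (V - (nbh E w \<inter> (nbh E u \<inter> low))))"
    by (rule card_UN_le) simp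
  finally have "real (card exc) \<le> (\<Sum>w\<in>core. real (card (V - (nbh E w \<inter> (nbh E u \<inter> low)))))"
    by (simp only: of_nat_le_iff flip: of_nat_sum)
  also have "\<dots> = (\<Sum>w\<in>core. real n - common u w)"
  proof (intro sum.cong refl)
    fix w
    have s: "nbh E w \<inter> (nbh E u \<inter> low) \<subseteq> V" using low_sub by auto
    show "real (card (V - (nbh E w \<inter> (nbh E u \<inter> low)))) = real n - common u w"
      using card_Diff_subset[OF _ s] card_mono[OF _ s] by (simp add: common_def of_nat_diff)
  qed
  also have "\<dots> = D" by (simp add: sum_subtractf D_def C_def card_core)
  finally show ?thesis using D2 by linarith
qed

lemma card_reg: "card reg \<ge> N"
proof -
  have "card V \<le> card (reg \<union> core \<union> exc)"
    by (rule card_mono) (auto simp: reg_def)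
  also have "\<dots> \<le> card reg + card core + card exc"
    using card_Un_le[of "reg \<union> core" exc] card_Un_le[of reg core] by linarith
  finally have "real n \<le> real (card reg) + real h + real (card exc)" using card_core by simp
  then have "real (card reg) \<ge> N" using card_exc N_sq_rho h_sq rho_small_abs rho_pos by linarith
  then show ?thesis by simp
qed

text \<open>With more than \<open>N\<close> regular neighbours, \<open>w\<close> would act as an
  additional core vertex, and \<open>h + 1\<close> of these yield the forest.\<close>

lemma few_reg_nbrs:
  assumes w: "w < n" "w \<notin> core"
  shows "card (nbh E w \<inter> reg) \<le> N"
proof (rule ccontr)
  assume a: "\<not> card (nbh E w \<inter> reg) \<le> N"
  define A where "A = insert w core"
  define B where "B = nbh E w \<inter> reg"
  have "B \<noteq> {}" using a N_ge_8 by (auto simp: B_def)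
  then obtain b0 where b0: "b0 \<in> B" by blast
  have "has_subgraph {0..<n} E (F_vert k l) (F_edges k l)"
  proof (rule has_F_if_dense_bipartite[OF simple _ k _ b0])
    show "A \<inter> B = {}" using nbh_irrefl[OF simple] reg_core by (auto simp: A_def B_def)
    show "A \<subseteq> V" using w core_sub by (auto simp: A_def)
    show "(k + 1) * l \<le> card (nbh E a \<inter> B)" if "a \<in> A" for a
    proof -
      have "B \<subseteq> nbh E a"
      proof
        fix b assume b: "b \<in> B"
        show "b \<in> nbh E a"
        proof (cases "a = w")
          case False
          then have "a \<in> nbh E b" using that b reg_nbh[of b] by (auto simp: A_def B_def)
          then show ?thesis by (simp only: nbh_sym)
        qed (use b in \<open>simp add: B_def\<close>)
      qed
      then have "nbh E a \<inter> B = B" by blast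
      then show ?thesis using a N_def by (simp add: B_def)
    qed
    show "k + l div 2 \<le> card (nbh E b \<inter> A)" if "b \<in> B" for b
    proof -
      have "w \<in> nbh E b" using that by (subst nbh_sym) (simp add: B_def)
      then have "nbh E b \<inter> A = A" using that reg_nbh[of b] by (auto simp: B_def A_def)
      then show ?thesis using card_core Suc_h w by (simp add: A_def)
    qed
  qed (use l in auto)
  then show False using not_F by simp
qed

text \<open>Improves the trivial bound 1 for hubs outside the core. In the eigenvalue equation the
  core, the regular neighbours and the hubs contribute at most \<open>N\<close> each; exceptional
  low vertices are up to \<open>2 * rho\<close> in number but have entries at most
  \<open>N / lam\<close>.\<close>

lemma off_core_entry:
  assumes w: "w < n" "w \<notin> core"
  shows "x w \<le> 5 * real N ^ 3 / lam"
proof -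
  have "lam * x w = (\<Sum>j\<in>nbh E w. x j)" using eigen w by simp
  also have "\<dots> \<le> (\<Sum>j\<in>core \<union> (nbh E w \<inter> reg) \<union> (exc \<inter> low) \<union> hubs. x j)"
    using nbhD x_nonneg by (intro sum_mono2) (auto simp: reg_def low_def)
  also have "\<dots> \<le> (\<Sum>j\<in>core. x j) + (\<Sum>j\<in>nbh E w \<inter> reg. x j) + (\<Sum>j\<in>exc \<inter> low. x j) + (\<Sum>j\<in>hubs. x j)"
  proof -
    have un: "sum x (P \<union> Q) \<le> sum x P + sum x Q" if "finite P" "finite Q" for P Q
      using sum.union_inter[OF that, of x] sum_nonneg[of "P \<inter> Q" x] x_nonneg by simp
    have "sum x (core \<union> (nbh E w \<inter> reg) \<union> (exc \<inter> low) \<union> hubs) \<le> sum x (core \<union> (nbh E w \<inter> reg) \<union> (exc \<inter> low)) + sum x hubs"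
      by (intro un) auto
    also have "sum x (core \<union> (nbh E w \<inter> reg) \<union> (exc \<inter> low)) \<le> sum x (core \<union> (nbh E w \<inter> reg)) + sum x (exc \<inter> low)"
      by (intro un) auto
    also have "sum x (core \<union> (nbh E w \<inter> reg)) \<le> sum x core + sum x (nbh E w \<inter> reg)"
      by (intro un) auto
    finally show ?thesis by simp
  qed
  also have "(\<Sum>j\<in>core. x j) \<le> N"
  proof -
    have "(\<Sum>j\<in>core. x j) \<le> (\<Sum>j\<in>core. 1)" using x_le_1 core_sub by (intro sum_mono) auto
    then show ?thesis using card_core h_N by simp
  qed
  also have "(\<Sum>j\<in>hubs. x j) \<le> N"
  proof -
    have "(\<Sum>j\<in>hubs. x j) \<le> (\<Sum>j\<in>hubs. 1)" using x_le_1 hubs_sub by (intro sum_mono) auto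
    then show ?thesis using card_hubs by simp
  qed
  also have "(\<Sum>j\<in>nbh E w \<inter> reg. x j) \<le> N"
  proof -
    have "(\<Sum>j\<in>nbh E w \<inter> reg. x j) \<le> (\<Sum>j\<in>nbh E w \<inter> reg. 1)" using x_le_1 nbhD by (intro sum_mono) auto
    then show ?thesis using few_reg_nbrs[OF w] by simp
  qed
  also have "(\<Sum>j\<in>exc \<inter> low. x j) \<le> 4 * real N ^ 3"
  proof -
    have "(\<Sum>j\<in>exc \<inter> low. x j) \<le> (\<Sum>j\<in>exc \<inter> low. N / lam)" using x_low by (intro sum_mono) auto
    also have "\<dots> = card (exc \<inter> low) * (N / lam)" by simp
    also have "\<dots> \<le> 2 * rho * (N / lam)"
    proof (intro mult_right_mono)
      have "card (exc \<inter> low) \<le> card exc" by (rule card_mono) auto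
      then show "real (card (exc \<inter> low)) \<le> 2 * rho" using card_exc by linarith
    qed (use lam_pos in auto)
    also have "\<dots> = 6 * real N ^ 3 * n / lam\<^sup>2"
      by (simp add: rho_def power2_eq_square power3_eq_cube)
    also have "\<dots> \<le> 4 * real N ^ 3"
    proof -
      have "3 * real n \<le> (real h + 1) * n" using h_ge_2 by (intro mult_right_mono) auto
      then have "3 * real n \<le> 2 * lam\<^sup>2" using lam_sq' by linarith
      then have "2 * real N ^ 3 * (3 * real n) \<le> 2 * real N ^ 3 * (2 * lam\<^sup>2)"
        by (intro mult_left_mono) auto
      then show ?thesis using lam_pos by (simp add: divide_le_eq)
    qed
    finally show ?thesis .
  qed
  also have "real N + real N + 4 * real N ^ 3 + real N \<le> 5 * real N ^ 3"
  proof -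
    have "3 * 1 \<le> real N * real N" using N_ge_8 by (intro mult_mono) auto
    then have "3 * real N \<le> real N * real N * real N" using N_ge_8 by (intro mult_right_mono) auto
    then show ?thesis by (simp add: power3_eq_cube)
  qed
  finally show ?thesis using lam_pos by (simp add: field_simps)
qed

end

subsection \<open>Comparison with the extremal graph\<close>

text \<open>Orientations are kept apart to match the double sum in \<open>qform\<close>, which sees
  every edge twice.\<close>

definition arcs :: "nat \<Rightarrow> nat set set \<Rightarrow> (nat \<times> nat) set" where
  "arcs n E = {(i, j). i < n \<and> j < n \<and> {i, j} \<in> E}"

definition arc_weight :: "(nat \<Rightarrow> real) \<Rightarrow> (nat \<times> nat) set \<Rightarrow> real" where
  "arc_weight x P = (\<Sum>(i, j)\<in>P. x i * x j)"

lemma finite_arcs [simp]: "finite (arcs n E)"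
  by (rule finite_subset[of _ "{0..<n} \<times> {0..<n}"]) (auto simp: arcs_def)

lemma qform_arcs: "qform n E x = arc_weight x (arcs n E)"
proof -
  have "qform n E x = (\<Sum>(i, j)\<in>{0..<n} \<times> {0..<n}. if (i, j) \<in> arcs n E then x i * x j else 0)"
    unfolding qform_def sum.cartesian_product by (intro sum.cong) (auto simp: edge_ind_def arcs_def)
  also have "\<dots> = (\<Sum>p\<in>{0..<n} \<times> {0..<n}. if p \<in> arcs n E then x (fst p) * x (snd p) else 0)"
    by (intro sum.cong) auto
  also have "\<dots> = (\<Sum>p\<in>({0..<n} \<times> {0..<n}) \<inter> arcs n E. x (fst p) * x (snd p))"
    by (rule sum.inter_restrict[symmetric]) simp
  also have "({0..<n} \<times> {0..<n}) \<inter> arcs n E = arcs n E" by (auto simp: arcs_def)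
  finally show ?thesis by (simp add: arc_weight_def case_prod_beta)
qed

lemma arcs_inj:
  assumes "simple_graph {0..<n} E" "simple_graph {0..<n} E'" "arcs n E \<subseteq> arcs n E'"
  shows "E \<subseteq> E'"
proof
  fix e assume e: "e \<in> E"
  then obtain a b where ab: "e = {a, b}" using assms(1) unfolding simple_graph_def by metis
  then have "(a, b) \<in> arcs n E" using simple_graph_edgeD[OF assms(1), of a b] e by (simp add: arcs_def)
  then have "(a, b) \<in> arcs n E'" using assms(3) by blast
  then show "e \<in> E'" using ab by (simp add: arcs_def)
qed

lemma arc_weight_diff:
  assumes "finite P" "finite Q"
  shows "arc_weight x P - arc_weight x Q = arc_weight x (P - Q) - arc_weight x (Q - P)"
proof -
  have "arc_weight x P = arc_weight x (P \<inter> Q) + arc_weight x (P - Q)"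
    unfolding arc_weight_def using assms by (simp add: sum.Int_Diff[symmetric])
  moreover have "arc_weight x Q = arc_weight x (P \<inter> Q) + arc_weight x (Q - P)"
    unfolding arc_weight_def Int_commute[of P] using assms by (simp add: sum.Int_Diff[symmetric])
  ultimately show ?thesis by simp
qed

lemma arc_weight_mono:
  assumes "\<And>i. x i \<ge> 0" "finite Q" "P \<subseteq> Q"
  shows "arc_weight x P \<le> arc_weight x Q"
  unfolding arc_weight_def using assms by (intro sum_mono2) auto

lemma arc_weight_nonneg: "(\<And>i. x i \<ge> 0) \<Longrightarrow> arc_weight x P \<ge> 0"
  unfolding arc_weight_def by (intro sum_nonneg) auto

lemma sum_edge_ind:
  assumes "simple_graph {0..<n} E"
  shows "(\<Sum>j\<in>{0..<n}. edge_ind E i j * x j) = (\<Sum>j\<in>nbh E i. x j)"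
proof -
  have "(\<Sum>j\<in>{0..<n}. edge_ind E i j * x j) = (\<Sum>j\<in>{0..<n}. if j \<in> nbh E i then x j else 0)"
    by (intro sum.cong) (auto simp: edge_ind_def nbh_def)
  also have "\<dots> = (\<Sum>j\<in>{0..<n} \<inter> nbh E i. x j)" by (rule sum.inter_restrict[symmetric]) simp
  also have "{0..<n} \<inter> nbh E i = nbh E i" using nbh_subset[OF assms] by blast
  finally show ?thesis .
qed

context spectral_core
begin

text \<open>Every lost arc has an exceptional end. Charged to such an end \<open>q\<close>, the arcs
  have at most \<open>3 * N\<close> possible other ends, all off the core with entries at most
  \<open>y\<close>.\<close>

lemma lost_weight:
  assumes P: "\<And>i j. (i, j) \<in> P \<Longrightarrow> i \<in> V - core \<and> j \<in> V - core \<and> j \<in> nbh E i \<and> \<not> (i \<in> reg \<and> j \<in> reg)"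
  shows "exc = {} \<Longrightarrow> P = {}" and "arc_weight x P \<le> (\<Sum>q\<in>exc. x q) / 4"
proof -
  have er: "i \<in> exc \<or> i \<in> reg" if "i \<in> V - core" for i using that by (auto simp: reg_def)
  show "P = {}" if "exc = {}"
  proof -
    have "(i, j) \<notin> P" for i j using P[of i j] er[of i] er[of j] that by auto
    then show ?thesis by auto
  qed
  \<comment> \<open>For two exceptional ends, a low end is charged through its few neighbours and a
    hub is charged as a partner of the other end; so \<open>D\<close> and its reversal cover all
    lost arcs.\<close>
  define J where "J q = (nbh E q \<inter> reg) \<union> (if q \<in> low then nbh E q - core else {}) \<union> (hubs - core)" for q
  define D where "D = Sigma exc J"
  define y where "y = 5 * real N ^ 3 / lam"
  have y: "y \<ge> 0" using lam_pos by (simp add: y_def)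
  have finJ: "finite (J q)" for q by (simp add: J_def)
  have finD: "finite D" unfolding D_def using finJ by (intro finite_SigmaI) auto
  have Jy: "x j \<le> y" if "j \<in> J q" for q j
  proof -
    have "j < n" "j \<notin> core"
      using that nbhD hubs_sub reg_core by (auto simp: J_def split: if_splits)
    then show ?thesis using off_core_entry by (simp add: y_def)
  qed
  have cJ: "card (J q) \<le> 3 * N" if "q \<in> exc" for q
  proof -
    have q: "q < n" "q \<notin> core" using that by (auto simp: exc_def)
    have "card (if q \<in> low then nbh E q - core else {}) \<le> N"
    proof (cases "q \<in> low")
      case True
      have "card (nbh E q - core) \<le> card (nbh E q)" by (rule card_mono) auto
      also have "\<dots> \<le> N" using True by (auto simp: low_def hubs_def)
      finally show ?thesis using True by simp
    qed simp
    moreover have "card (hubs - core) \<le> N"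
      using card_mono[of hubs "hubs - core"] card_hubs by simp
    moreover have "card (nbh E q \<inter> reg) \<le> N" by (rule few_reg_nbrs[OF q])
    moreover have "card (J q) \<le> card (nbh E q \<inter> reg) + card (if q \<in> low then nbh E q - core else {}) + card (hubs - core)"
      unfolding J_def by (meson card_Un_le add_le_mono order_trans order_refl)
    ultimately show ?thesis by linarith
  qed
  have "arc_weight x D = (\<Sum>q\<in>exc. \<Sum>j\<in>J q. x q * x j)"
    unfolding arc_weight_def D_def using finJ by (subst sum.Sigma) auto
  also have "\<dots> \<le> (\<Sum>q\<in>exc. x q * (3 * N * y))"
  proof (intro sum_mono)
    fix q assume q: "q \<in> exc"
    have "(\<Sum>j\<in>J q. x q * x j) = x q * (\<Sum>j\<in>J q. x j)" by (simp add: sum_distrib_left)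
    also have "(\<Sum>j\<in>J q. x j) \<le> (\<Sum>j\<in>J q. y)" using Jy by (intro sum_mono) auto
    then have "x q * (\<Sum>j\<in>J q. x j) \<le> x q * (card (J q) * y)"
      using x_nonneg by (intro mult_left_mono) auto
    also have "\<dots> \<le> x q * (3 * N * y)"
    proof -
      have "real (card (J q)) \<le> real (3 * N)" using cJ[OF q] by (simp only: of_nat_le_iff)
      then have "real (card (J q)) * y \<le> 3 * N * y" using y by (intro mult_right_mono) auto
      then show ?thesis using x_nonneg by (intro mult_left_mono) auto
    qed
    finally show "(\<Sum>j\<in>J q. x q * x j) \<le> x q * (3 * N * y)" .
  qed
  also have "\<dots> = (\<Sum>q\<in>exc. x q) * (3 * N * y)" by (simp add: sum_distrib_right)
  \<comment> \<open>One eighth for each orientation gives the quarter of the conclusion.\<close>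
  also have "\<dots> \<le> (\<Sum>q\<in>exc. x q) * (1 / 8)"
  proof (rule mult_left_mono)
    have "3 * N * y = 15 * real N ^ 4 / lam" by (simp add: y_def power4_eq_xxxx power3_eq_cube)
    also have "\<dots> \<le> 1 / 8"
    proof -
      have "real N ^ 4 \<ge> 0" by simp
      then have "8 * (15 * real N ^ 4) \<le> lam" using lam_N4 by linarith
      then show ?thesis using lam_pos by (simp add: field_simps)
    qed
    finally show "3 * N * y \<le> 1 / 8" .
  qed (use x_nonneg in \<open>auto intro: sum_nonneg\<close>)
  finally have wD: "arc_weight x D \<le> (\<Sum>q\<in>exc. x q) / 8" by simp
  have sw: "arc_weight x (prod.swap ` D) = arc_weight x D"
    unfolding arc_weight_def by (subst sum.reindex) (auto simp: case_prod_beta mult.commute)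
  have "P \<subseteq> D \<union> prod.swap ` D"
  proof
    fix p assume "p \<in> P"
    obtain i j where p: "p = (i, j)" by (cases p)
    note ij = P[OF \<open>p \<in> P\<close>[unfolded p]]
    have ji: "i \<in> nbh E j" using ij nbh_sym by blast
    have lowhub: "v \<in> low \<or> v \<in> hubs - core" if "v \<in> V - core" for v using that by (auto simp: low_def)
    have "(i, j) \<in> D \<or> (j, i) \<in> D"
      using er[of i] er[of j] ij ji lowhub[of i] lowhub[of j] by (auto simp: D_def J_def)
    then show "p \<in> D \<union> prod.swap ` D" using p by force
  qed
  then have "arc_weight x P \<le> arc_weight x (D \<union> prod.swap ` D)"
    using finD x_nonneg by (intro arc_weight_mono) auto
  also have "\<dots> \<le> arc_weight x D + arc_weight x (prod.swap ` D)"
  proof -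
    have "arc_weight x (D \<union> prod.swap ` D) + arc_weight x (D \<inter> prod.swap ` D) = arc_weight x D + arc_weight x (prod.swap ` D)"
      unfolding arc_weight_def using finD by (intro sum.union_inter) auto
    then show ?thesis using arc_weight_nonneg[of x "D \<inter> prod.swap ` D"] x_nonneg by simp
  qed
  finally show "arc_weight x P \<le> (\<Sum>q\<in>exc. x q) / 4" using wD sw by simp
qed

text \<open>Each exceptional vertex gains an arc to a core vertex it misses, whose entry is at least
  1/2.\<close>

lemma gained_weight:
  assumes "finite P"
    and P: "\<And>q c. q \<in> exc \<Longrightarrow> c \<in> core \<Longrightarrow> c \<notin> nbh E q \<Longrightarrow> (q, c) \<in> P"
  shows "arc_weight x P \<ge> (\<Sum>q\<in>exc. x q) / 2"
proof -
  have "\<exists>c. c \<in> core \<and> c \<notin> nbh E q" if "q \<in> exc" for q using that by (auto simp: exc_def)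
  then obtain c where c: "\<And>q. q \<in> exc \<Longrightarrow> c q \<in> core \<and> c q \<notin> nbh E q" by metis
  have "(\<Sum>q\<in>exc. x q) / 2 = (\<Sum>q\<in>exc. x q * (1 / 2))" by (simp add: sum_divide_distrib)
  also have "\<dots> \<le> (\<Sum>q\<in>exc. x q * x (c q))"
    using core_entry_half c x_nonneg by (intro sum_mono mult_left_mono) auto
  also have "\<dots> = arc_weight x ((\<lambda>q. (q, c q)) ` exc)"
    unfolding arc_weight_def by (subst sum.reindex) (auto simp: inj_on_def)
  also have "\<dots> \<le> arc_weight x P"
    using assms(1) c P x_nonneg by (intro arc_weight_mono) auto
  finally show ?thesis .
qed

text \<open>Optimality bounds the gain by the loss, that is \<open>s / 2 \<le> s / 4\<close>. Hence
  both weights vanish, and strict positivity of \<open>x\<close> turns zero weight into absence of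
  arcs.\<close>

lemma eq_extremal:
  assumes T: "T = {} \<or> (\<exists>a b. T = {{a, b}} \<and> a \<in> reg \<and> b \<in> reg \<and> a \<noteq> b)"
    and reg_edges: "\<And>i j. i \<in> reg \<Longrightarrow> j \<in> reg \<Longrightarrow> {i, j} \<in> E \<Longrightarrow> {i, j} \<in> T"
    and le: "spec_rad n (full_join n core \<union> T) \<le> lam"
  shows "E = full_join n core \<union> T"
proof -
  define Es where "Es = full_join n core \<union> T"
  define s where "s = (\<Sum>q\<in>exc. x q)"
  have n0: "n > 0" using u by simp
  have regV: "reg \<subseteq> V" by (auto simp: reg_def)
  have simpleEs: "simple_graph V Es"
    unfolding Es_def
  proof (rule simple_full_join)
    have "a < n" if "a \<in> reg" for a using that regV by auto
    then show "T = {} \<or> (\<exists>a b. T = {{a, b}} \<and> a < n \<and> b < n \<and> a \<noteq> b)"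
      using T by metis
  qed
  have E_arc: "(i, j) \<in> arcs n E \<longleftrightarrow> j \<in> nbh E i" for i j
    using simple_graph_edgeD[OF simple, of i j] by (auto simp: arcs_def nbh_def)
  have lost: "i \<in> V - core \<and> j \<in> V - core \<and> j \<in> nbh E i \<and> \<not> (i \<in> reg \<and> j \<in> reg)"
    if ij: "(i, j) \<in> arcs n E - arcs n Es" for i j
  proof -
    have e: "{i, j} \<in> E" "i < n" "j < n" "{i, j} \<notin> Es" using ij by (auto simp: arcs_def)
    have "i \<noteq> j" using simple_graph_edgeD[OF simple e(1)] by simp
    then have "i \<notin> core" "j \<notin> core" using e by (auto simp: Es_def in_full_join)
    moreover have "\<not> (i \<in> reg \<and> j \<in> reg)" using reg_edges e by (auto simp: Es_def)
    ultimately show ?thesis using e by (simp add: nbh_def)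
  qed
  have gain: "(q, c) \<in> arcs n Es - arcs n E" if "q \<in> exc" "c \<in> core" "c \<notin> nbh E q" for q c
  proof -
    have "q < n" "c < n" "q \<noteq> c" using that core_sub by (auto simp: exc_def)
    then have "(q, c) \<in> arcs n Es" using that by (simp add: arcs_def Es_def in_full_join)
    then show ?thesis using that E_arc by simp
  qed
  have wl: "arc_weight x (arcs n E - arcs n Es) \<le> s / 4"
    unfolding s_def by (rule lost_weight(2)) (rule lost)
  have wg: "arc_weight x (arcs n Es - arcs n E) \<ge> s / 2"
    unfolding s_def by (rule gained_weight) (use gain in auto)
  have s0: "s \<ge> 0" unfolding s_def using x_nonneg by (intro sum_nonneg) auto
  have qE: "qform n E x = lam * sqn n x"
    by (rule eigenvector_qform) (simp add: sum_edge_ind[OF simple] eigen)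
  have qEs: "qform n Es x \<le> spec_rad n Es * sqn n x" by (rule spec_rad_Rayleigh(2)[OF n0])
  have "spec_rad n Es * sqn n x \<le> lam * sqn n x"
    using le sqn_nonneg[of n x] unfolding Es_def by (intro mult_right_mono) auto
  then have "qform n Es x \<le> qform n E x" using qE qEs by linarith
  then have "arc_weight x (arcs n Es - arcs n E) \<le> arc_weight x (arcs n E - arcs n Es)"
    using arc_weight_diff[of "arcs n Es" "arcs n E" x] by (simp add: qform_arcs)
  then have s_eq: "s = 0" and wg0: "arc_weight x (arcs n Es - arcs n E) \<le> 0"
    using wl wg s0 by linarith+
  have "arc_weight x (arcs n E - arcs n Es) \<ge> 0" "arc_weight x (arcs n Es - arcs n E) \<ge> 0"
    using arc_weight_nonneg x_nonneg by blast+
  then have "qform n Es x = qform n E x"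
    using wl wg0 s_eq arc_weight_diff[of "arcs n Es" "arcs n E" x] by (simp add: qform_arcs)
  then have eq: "qform n Es x = spec_rad n Es * sqn n x"
    using qE qEs \<open>spec_rad n Es * sqn n x \<le> lam * sqn n x\<close> by linarith
  \<comment> \<open>By \<open>eq\<close>, \<open>x\<close> is also an eigenvector of the comparison
    graph, where every vertex has a core neighbour other than itself since
    \<open>h \<ge> 2\<close>.\<close>
  have pos: "x v > 0" if v: "v < n" for v
  proof -
    have "card (core - {v}) \<noteq> 0"
      using card_core h_ge_2 by (simp add: card_Diff_singleton_if)
    then obtain w where w: "w \<in> core" "w \<noteq> v" by (metis card.empty Diff_iff ex_in_conv singletonI)
    have wn: "w < n" using w core_sub by auto
    have "w \<in> nbh Es v" using w wn v by (simp add: nbh_def Es_def in_full_join)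
    then have "x w \<le> (\<Sum>j\<in>nbh Es v. x j)"
      using finite_nbh[OF simpleEs] x_nonneg by (intro member_le_sum) auto
    also have "\<dots> = spec_rad n Es * x v"
      using maximiser_is_eigenvector[OF spec_rad_Rayleigh(2)[OF n0] eq v]
      by (simp add: sum_edge_ind[OF simpleEs])
    finally have "spec_rad n Es * x v \<noteq> 0" using core_entry_half[OF w(1)] by linarith
    then show ?thesis using x_nonneg[of v] by (auto simp: less_le)
  qed
  have "exc = {}"
  proof (rule ccontr)
    assume "exc \<noteq> {}"
    then have "s > 0" unfolding s_def using pos exc_sub by (intro sum_pos) auto
    then show False using s_eq by simp
  qed
  then have "arcs n E - arcs n Es = {}" using lost_weight(1)[OF lost] by blast
  then have sub1: "arcs n E \<subseteq> arcs n Es" by blast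
  have sub2: "arcs n Es \<subseteq> arcs n E"
  proof (rule ccontr)
    assume "\<not> arcs n Es \<subseteq> arcs n E"
    then have "arcs n Es - arcs n E \<noteq> {}" by blast
    then have "arc_weight x (arcs n Es - arcs n E) > 0"
      unfolding arc_weight_def
    proof (intro sum_pos)
      show "0 < (case p of (i, j) \<Rightarrow> x i * x j)" if "p \<in> arcs n Es - arcs n E" for p
        using that pos by (auto simp: arcs_def)
    qed simp_all
    then show False using wg0 by simp
  qed
  show ?thesis
    using arcs_inj[OF simple simpleEs sub1] arcs_inj[OF simpleEs simple sub2] unfolding Es_def by blast
qed

end

subsection \<open>Uniqueness of the extremal graph\<close>

text \<open>The explicit \<open>t\<close> enters through \<open>3 * N \<le> t\<close>, which holds
  because \<open>l \<ge> 4\<close> gives \<open>l^2 \<ge> 4 * l\<close>.\<close>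

lemma param_bounds:
  fixes k l n h N :: nat and t :: real
  assumes k: "k \<ge> 1" and l: "l \<ge> 4"
    and t: "t = (real l ^ 2 - real l + 1) * real k + (real l ^ 2 + 3 * real l - 2) / 2"
    and n: "real n \<ge> 8 * (real k + real (l div 2)) ^ 3 * t ^ 8"
    and h: "h = k + l div 2 - 1" and N: "N = (k + 1) * l"
  shows "3 * real N \<le> t" "real n \<ge> 8 * (real h + 1) ^ 3 * t ^ 8" "h \<ge> 2" "l div 2 \<le> h"
    "real l \<le> N" "2 * (real h)\<^sup>2 < n" "h + 2 \<le> n"
proof -
  have l4: "real l * real l \<ge> 4 * real l" using l by (intro mult_right_mono) auto
  have l4': "real l \<ge> 4" using l by simp
  have a: "real l ^ 2 - real l + 1 \<ge> 3 * real l" unfolding power2_eq_square using l4 by linarith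
  have b: "(real l ^ 2 + 3 * real l - 2) / 2 \<ge> 3 * real l"
  proof -
    have "2 * (3 * real l) \<le> real l ^ 2 + 3 * real l - 2"
      unfolding power2_eq_square using l4 l4' by linarith
    then show ?thesis by simp
  qed
  have "(real l ^ 2 - real l + 1) * real k \<ge> 3 * real l * real k" using a by (intro mult_right_mono) auto
  moreover have "3 * real N = 3 * real l * real k + 3 * real l" unfolding N by (simp add: algebra_simps)
  ultimately show tN: "3 * real N \<le> t" unfolding t using b by linarith
  have l2: "l div 2 \<ge> 2" using l by linarith
  have "real k + real (l div 2) = real h + 1" using h k l2 by (simp add: of_nat_diff)
  then show n': "real n \<ge> 8 * (real h + 1) ^ 3 * t ^ 8" using n by simp
  show "h \<ge> 2" "l div 2 \<le> h" using h k l2 by auto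
  show lN: "real l \<le> N" unfolding N by simp
  have t1: "t \<ge> 1" using tN lN l4' by linarith
  then have "8 * (real h + 1) ^ 3 * 1 \<le> 8 * (real h + 1) ^ 3 * t ^ 8"
    by (intro mult_left_mono one_le_power) auto
  then have n3: "real n \<ge> 8 * (real h + 1) ^ 3" using n' by linarith
  have "(real h + 1) ^ 2 \<le> (real h + 1) ^ 3" by (intro power_increasing) auto
  then have n2: "real n \<ge> 8 * (real h + 1) ^ 2" using n3 by linarith
  have "(real h + 1) ^ 2 = (real h)\<^sup>2 + 2 * real h + 1" by (simp add: power2_eq_square algebra_simps)
  moreover have "(real h)\<^sup>2 \<ge> 0" by simp
  ultimately have "2 * (real h)\<^sup>2 < n" "real h + 2 \<le> n" using n2 of_nat_0_le_iff[of h] by linarith+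
  then show "2 * (real h)\<^sup>2 < n" "h + 2 \<le> n" by linarith+
qed

lemma simple_S_graph: "simple_graph {0..<n} (S_graph n h)"
  using simple_full_join[of "{}" n "{0..<h}"] by (simp add: S_graph_eq)

lemma simple_S_plus_graph:
  assumes "h + 2 \<le> n"
  shows "simple_graph {0..<n} (S_plus_graph n h)"
  unfolding S_plus_graph_def S_graph_eq
proof (rule simple_full_join, rule disjI2, intro exI conjI)
  show "{{h, h + 1}} = {{h, h + 1}}" ..
qed (use assms in auto)

text \<open>Assuming only a radius at least that of the candidate, instead of extremality, lets both
  directions of the characterisation follow from this one statement.\<close>

lemma extremal_structure:
  fixes k l n h :: nat and t :: real
  assumes k: "k \<ge> 1" and l: "l \<ge> 4"
    and t: "t = (real l ^ 2 - real l + 1) * real k + (real l ^ 2 + 3 * real l - 2) / 2"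
    and n: "real n \<ge> 8 * (real k + real (l div 2)) ^ 3 * t ^ 8"
    and h: "h = k + l div 2 - 1"
    and E: "simple_graph {0..<n} E" and free: "F_free (F_vert k l) (F_edges k l) {0..<n} E"
    and big: "spec_rad n (if even l then S_graph n h else S_plus_graph n h) \<le> spec_rad n E"
  shows "graph_iso n (if even l then S_graph n h else S_plus_graph n h) E"
proof -
  define N where "N = (k + 1) * l"
  note pb = param_bounds[OF k l t n h N_def]
  have n0: "n > 0" using pb(7) by simp
  obtain x u where x: "\<And>i. x i \<ge> 0" "\<And>i. i < n \<Longrightarrow> x i \<le> 1" "u < n" "x u = 1"
    "\<And>i. i < n \<Longrightarrow> (\<Sum>j\<in>{0..<n}. edge_ind E i j * x j) = spec_rad n E * x i"
    using spec_rad_eigenvector[OF n0, of E] by metis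
  define lam where "lam = spec_rad n E"
  interpret graph_eigenvector n E x lam u
  proof
    show "(\<Sum>j\<in>nbh E i. x j) = lam * x i" if "i < n" for i
      using x(5)[OF that] unfolding lam_def sum_edge_ind[OF E] .
  qed (use E x in auto)
  have "spec_rad n (S_graph n h) \<le> spec_rad n (S_plus_graph n h)"
    by (rule spec_rad_mono[OF n0]) (auto simp: S_plus_graph_def)
  then have Sle: "spec_rad n (S_graph n h) \<le> lam" using big unfolding lam_def by (auto split: if_splits)
  have hn: "h \<le> n" "0 < h" using pb by auto
  have lam0: "lam \<ge> 0" using spec_rad_S_graph_ge(2)[OF hn] Sle by linarith
  have "(spec_rad n (S_graph n h))\<^sup>2 \<le> lam\<^sup>2"
    using spec_rad_S_graph_ge(2)[OF hn] Sle by (intro power_mono) auto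
  then have lsq: "real h * (real n - real h) \<le> lam\<^sup>2"
    using spec_rad_S_graph_ge(1)[OF hn] hn by (simp add: of_nat_diff)
  have lsq': "(real h + 1) * real n \<le> 2 * lam\<^sup>2"
  proof -
    have "1 * real n \<le> (real h - 1) * real n" using pb(3) by (intro mult_right_mono) auto
    then have "2 * (real h)\<^sup>2 \<le> (real h - 1) * real n" using pb(6) by linarith
    then have "(real h + 1) * real n \<le> 2 * (real h * (real n - real h))"
      by (simp add: algebra_simps power2_eq_square)
    then show ?thesis using lsq by linarith
  qed
  have tpos: "t > 0" using pb(1,5) l by linarith
  have lbig: "162 * (real h + 1)\<^sup>2 * real N ^ 4 \<le> lam"
  proof -
    \<comment> \<open>\<open>lam^2 \<ge> (h + 1) * n / 2 \<ge> 4 * (h + 1)^4 * t^8\<close> has the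
      square root \<open>2 * (h + 1)^2 * t^4\<close>, and \<open>t^4 \<ge> 81 * N^4\<close> produces
      162.\<close>
    have "(real h + 1) * (8 * (real h + 1) ^ 3 * t ^ 8) \<le> (real h + 1) * real n"
      using pb(2) by (intro mult_left_mono) auto
    moreover have "(real h + 1) * (8 * (real h + 1) ^ 3 * t ^ 8) = 2 * (2 * (real h + 1)\<^sup>2 * t ^ 4)\<^sup>2"
      by (simp add: power_mult_distrib power_add[symmetric] power_mult[symmetric] eval_nat_numeral)
    ultimately have "(2 * (real h + 1)\<^sup>2 * t ^ 4)\<^sup>2 \<le> lam\<^sup>2" using lsq' by linarith
    then have "2 * (real h + 1)\<^sup>2 * t ^ 4 \<le> lam" by (rule power2_le_imp_le) (rule lam0)
    moreover have "(3 * real N) ^ 4 \<le> t ^ 4" using pb(1) by (intro power_mono) auto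
    then have "2 * (real h + 1)\<^sup>2 * (81 * real N ^ 4) \<le> 2 * (real h + 1)\<^sup>2 * t ^ 4"
      by (intro mult_left_mono) (auto simp: power_mult_distrib)
    ultimately show ?thesis by linarith
  qed
  have path: "\<exists>xs. is_path E xs \<and> length xs = l"
  proof (rule contains_path[OF l pb(4) lsq])
    have N1: "real N \<ge> 1" using pb(5) l by linarith
    have "real l ^ 3 \<le> real N ^ 3" using pb(5) by (intro power_mono) auto
    also have "\<dots> \<le> real N ^ 4" using N1 by (intro power_increasing) auto
    finally have "192 * 1 * real l ^ 3 \<le> 192 * 1 * real N ^ 4" by simp
    moreover have "(3::real)\<^sup>2 \<le> (real h + 1)\<^sup>2" using pb(3) by (intro power_mono) auto
    then have "162 * 9 * real N ^ 4 \<le> 162 * (real h + 1)\<^sup>2 * real N ^ 4"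
      by (intro mult_right_mono) auto
    moreover have "real N ^ 4 \<ge> 0" by simp
    ultimately show "192 * real l ^ 3 \<le> lam" using lbig by linarith
    show "2 * (real h)\<^sup>2 < real n" by (rule pb(6))
  qed
  interpret spectral_core n E x lam u k l h N
    by unfold_locales (fact k l h N_def free lsq lsq' lbig path)+
  have cardc: "card core = k + l div 2 - 1" using card_core h by simp
  have regN: "card reg \<ge> (k + 1) * l" using card_reg N_def by simp
  have off1: "{i, j} \<notin> E" if "even l" "i \<in> reg" "j \<in> reg" for i j
    by (rule edges_off_core(1)[OF E l free k core_sub cardc reg_core _ regN fin_reg that]) (rule reg_nbh)
  have off2: "{i, j} = {w, z}" if "odd l" "i \<in> reg" "j \<in> reg" "w \<in> reg" "z \<in> reg" "{i, j} \<in> E" "{w, z} \<in> E" for i j w z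
    by (rule edges_off_core(2)[OF E l free k core_sub cardc reg_core _ regN fin_reg that]) (rule reg_nbh)
  have regn: "a < n" "a \<notin> core" if "a \<in> reg" for a using that by (auto simp: reg_def)
  show ?thesis
  proof (cases "even l")
    case True
    have iso: "graph_iso n (S_graph n h) (full_join n core)"
      by (rule iso_S_graph[OF core_sub card_core])
    have "E = full_join n core \<union> {}"
    proof (rule eq_extremal)
      show "spec_rad n (full_join n core \<union> {}) \<le> lam"
        using spec_rad_graph_iso[OF n0 simple_S_graph iso] Sle by simp
    qed (use off1[OF True] in auto)
    then show ?thesis using iso True by simp
  next
    case False
    obtain a b where ab: "a \<in> reg" "b \<in> reg" "a \<noteq> b"
      "\<And>i j. i \<in> reg \<Longrightarrow> j \<in> reg \<Longrightarrow> {i, j} \<in> E \<Longrightarrow> {i, j} = {a, b}"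
    proof (cases "\<exists>a b. a \<in> reg \<and> b \<in> reg \<and> {a, b} \<in> E")
      case True
      then obtain a b where ab: "a \<in> reg" "b \<in> reg" "{a, b} \<in> E" by blast
      have "a \<noteq> b" using simple_graph_edgeD[OF E ab(3)] by simp
      then show thesis using that[of a b] ab off2[OF False, of _ _ a b] by blast
    next
      \<comment> \<open>If the regular vertices span no edge, any two of them may carry the extra
        edge of the comparison graph.\<close>
      case none: False
      have "card reg \<ge> 2" using card_reg N_ge_8 by linarith
      then have "\<not> card reg \<le> Suc 0" by simp
      then obtain a b where "a \<in> reg" "b \<in> reg" "a \<noteq> b"
        unfolding card_le_Suc0_iff_eq[OF fin_reg] by blast
      then show thesis using that none by blast
    qed
    have iso: "graph_iso n (S_plus_graph n h) (full_join n core \<union> {{a, b}})"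
      using regn ab by (intro iso_S_plus_graph[OF core_sub card_core]) auto
    have "E = full_join n core \<union> {{a, b}}"
    proof (rule eq_extremal)
      show "spec_rad n (full_join n core \<union> {{a, b}}) \<le> lam"
        using spec_rad_graph_iso[OF n0 simple_S_plus_graph[OF pb(7)] iso] big False unfolding lam_def by simp
      show "{{a, b}} = {} \<or> (\<exists>a' b'. {{a, b}} = {{a', b'}} \<and> a' \<in> reg \<and> b' \<in> reg \<and> a' \<noteq> b')"
        using ab(1-3) by blast
      show "{i, j} \<in> {{a, b}}" if "i \<in> reg" "j \<in> reg" "{i, j} \<in> E" for i j
        using ab(4)[OF that] by simp
    qed
    then show ?thesis using iso False by simp
  qed
qed

theorem theorem1p12:
  fixes k l n :: nat and t :: real
  assumes "k \<ge> 1" and "l \<ge> 4"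
    and "t = (real l ^ 2 - real l + 1) * real k + (real l ^ 2 + 3 * real l - 2) / 2"
    and "real n \<ge> 8 * (real k + real (l div 2)) ^ 3 * t ^ 8"
  shows "(even l \<longrightarrow>
            (\<forall>E. spex (F_vert k l) (F_edges k l) n E \<longleftrightarrow>
                 simple_graph {0..<n} E \<and> graph_iso n (S_graph n ((2*k + l - 2) div 2)) E))
       \<and> (odd l \<longrightarrow>
            (\<forall>E. spex (F_vert k l) (F_edges k l) n E \<longleftrightarrow>
                 simple_graph {0..<n} E \<and> graph_iso n (S_plus_graph n ((2*k + l - 3) div 2)) E))"
proof -
  define h where "h = k + l div 2 - 1"
  define X where "X = (if even l then S_graph n h else S_plus_graph n h)"
  note pb = param_bounds[OF assms h_def refl]
  have n0: "n > 0" using pb(7) by simp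
  have simpleX: "simple_graph {0..<n} X"
    using simple_S_graph simple_S_plus_graph[OF pb(7)] by (simp add: X_def)
  have free_iso: "F_free (F_vert k l) (F_edges k l) {0..<n} E" if iso: "graph_iso n X E" for E
  proof -
    obtain L T where L: "L \<subseteq> {0..<n}" "card L = h" "E = full_join n L \<union> T"
      "T = {} \<or> odd l \<and> (\<exists>e. T = {e})"
    proof (cases "even l")
      case True
      then obtain L where "L \<subseteq> {0..<n}" "card L = h" "E = full_join n L"
        using S_graph_iso_imp[of n h E] iso pb(7) unfolding X_def by auto
      then show thesis using that[of L "{}"] by simp
    next
      case False
      then obtain L e where "L \<subseteq> {0..<n}" "card L = h" "E = full_join n L \<union> {e}"
        using S_plus_graph_iso_imp[of n h E] iso pb(7) unfolding X_def by auto
      then show thesis using that[of L "{e}"] False by simp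
    qed
    show ?thesis
      unfolding L(3) using L assms(1,2) finite_subset[OF L(1)] h_def by (intro full_join_F_free) auto
  qed
  have isoX: "graph_iso n X X"
    unfolding graph_iso_def by (intro exI[of _ id]) simp
  have main: "graph_iso n X E"
    if "simple_graph {0..<n} E" "F_free (F_vert k l) (F_edges k l) {0..<n} E" "spec_rad n X \<le> spec_rad n E" for E
    using extremal_structure[OF assms h_def that(1,2)] that(3) unfolding X_def by blast
  have "spex (F_vert k l) (F_edges k l) n E \<longleftrightarrow> simple_graph {0..<n} E \<and> graph_iso n X E" for E
  proof
    assume "spex (F_vert k l) (F_edges k l) n E"
    then have E: "simple_graph {0..<n} E" "F_free (F_vert k l) (F_edges k l) {0..<n} E"
      "\<And>E'. simple_graph {0..<n} E' \<Longrightarrow> F_free (F_vert k l) (F_edges k l) {0..<n} E' \<Longrightarrow> spec_rad n E' \<le> spec_rad n E"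
      unfolding spex_def by blast+
    then show "simple_graph {0..<n} E \<and> graph_iso n X E"
      using main[OF E(1,2) E(3)[OF simpleX free_iso[OF isoX]]] by blast
  next
    assume E: "simple_graph {0..<n} E \<and> graph_iso n X E"
    have eq: "spec_rad n E = spec_rad n X"
      using spec_rad_graph_iso[OF n0 simpleX] E by blast
    \<comment> \<open>A competitor with larger radius would by \<open>main\<close> be isomorphic to
      \<open>X\<close> and so have the same radius; no separate existence argument for a maximiser
      is required.\<close>
    have "spec_rad n E' \<le> spec_rad n E"
      if "simple_graph {0..<n} E'" "F_free (F_vert k l) (F_edges k l) {0..<n} E'" for E'
    proof (rule ccontr)
      assume less: "\<not> spec_rad n E' \<le> spec_rad n E"
      then have "graph_iso n X E'" using main[OF that] eq by linarith
      then have "spec_rad n E' = spec_rad n X" by (rule spec_rad_graph_iso[OF n0 simpleX])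
      then show False using less eq by simp
    qed
    then show "spex (F_vert k l) (F_edges k l) n E"
      unfolding spex_def using E free_iso by blast
  qed
  moreover have "(2 * k + l - 2) div 2 = h" if "even l"
    using that assms(1,2) unfolding h_def by (auto elim!: evenE)
  moreover have "(2 * k + l - 3) div 2 = h" if "odd l"
    using that assms(1,2) unfolding h_def by (auto elim!: oddE)
  ultimately show ?thesis unfolding X_def by auto
qed

end
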